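(* Assume the setting described in the context ($\xi$ in the domain of attraction of the normal law, $\alpha=2$, with normalising sequence $(a_n)$ and centering $b_n=n\mu$), and assume that $\overline F$ is intermediate regularly varying. If $(x_n)$ satisfies $\lim_{n\to\infty}\frac{x_n}{a_n}=\infty$ and $\lim_{n\to\infty}\frac{n\overline F(x_n)}{\mathbb P(S_n-b_n\ge x_n)}=s\in[0,1]$, then $$\mathscr L\Big(\frac{M_n}{S_n-b_n}\ \Big|\ S_n-b_n\ge x_n\Big)\xrightarrow[n\to\infty]{w}(1-s)\,\delta_0+s\,\delta_1,$$ where $\xrightarrow{w}$ denotes weak convergence.
   Context: $\xi$ is a real random variable, $\xi_1,\xi_2,\dots$ are i.i.d. copies, $F(x)=\mathbb P(\xi\le x)$, $\overline F=1-F$, $S_n=\sum_{i=1}^n\xi_i$, $M_n=\max\{\xi_1,\dots,\xi_n\}$. Setting "$\alpha=2$": $\mathbb E|\xi|<\infty$, $\mu=\mathbb E[\xi]$, and the truncated variance $\sigma^2(x)=\mathbb E[(\xi-\mu)^2\mathbf 1_{\{|\xi-\mu|\le x\}}]$ is slowly varying as $x\to\infty$ (the variance may be finite or infinite). $(a_n)$ is a positive sequence, $a_n\to\infty$, with $\sigma^2(a_n)a_n^{-2}\sim n^{-1}$; $b_n=n\mu$. $\mathscr L(X\mid A)$ is the law of $X$ conditioned on the event $A$; $\delta_z$ is the Dirac mass at $z$. A (eventually positive) function $f$ is intermediate regularly varying if $\lim_{\lambda\downarrow1}\liminf_{x\to\infty}\frac{f(\lambda x)}{f(x)}=\lim_{\lambda\downarrow1}\limsup_{x\to\infty}\frac{f(\lambda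 x)}{f(x)}=1$. *)

theory Defs
  imports "HOL-Probability.Probability" "HOL-Library.Landau_Symbols"
begin

definition slowly_varying :: "(real \<Rightarrow> real) \<Rightarrow> bool" where
  "slowly_varying f \<longleftrightarrow>
     (\<exists>x0. set_borel_measurable borel {x0..} f \<and> (\<forall>x\<ge>x0. 0 < f x)) \<and>
     (\<forall>l>0. ((\<lambda>x. f (l * x) / f x) \<longlongrightarrow> 1) at_top)"

text \<open>The inner limits are taken in \<^typ>\<open>ereal\<close>, since they may be infinite for some \<open>l > 1\<close>.\<close>

definition intermediate_regularly_varying :: "(real \<Rightarrow> real) \<Rightarrow> bool" where
  "intermediate_regularly_varying f \<longleftrightarrow>
     (\<forall>\<^sub>F x in at_top. 0 < f x) \<and>
     ((\<lambda>l. Liminf at_top (\<lambda>x. ereal (f (l * x) / f x))) \<longlongrightarrow> 1) (at_right 1) \<and>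
     ((\<lambda>l. Limsup at_top (\<lambda>x. ereal (f (l * x) / f x))) \<longlongrightarrow> 1) (at_right 1)"

definition tail :: "'a measure \<Rightarrow> ('a \<Rightarrow> real) \<Rightarrow> real \<Rightarrow> real" where
  "tail M \<xi> x = 1 - cdf (distr M borel \<xi>) x"

definition mean :: "'a measure \<Rightarrow> ('a \<Rightarrow> real) \<Rightarrow> real" where
  "mean M \<xi> = (\<integral>\<omega>. \<xi> \<omega> \<partial>M)"

definition trunc_var :: "'a measure \<Rightarrow> ('a \<Rightarrow> real) \<Rightarrow> real \<Rightarrow> real" where
  "trunc_var M \<xi> x =
     (\<integral>\<omega>. (\<xi> \<omega> - mean M \<xi>)\<^sup>2 * indicator {\<omega>. \<bar>\<xi> \<omega> - mean M \<xi>\<bar> \<le> x} \<omega> \<partial>M)"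

definition iid_copies :: "'a measure \<Rightarrow> ('a \<Rightarrow> real) \<Rightarrow> (nat \<Rightarrow> 'a \<Rightarrow> real) \<Rightarrow> bool" where
  "iid_copies M \<xi> X \<longleftrightarrow>
     prob_space.indep_vars M (\<lambda>_. borel) X {1..} \<and>
     (\<forall>i\<ge>1. distr M borel (X i) = distr M borel \<xi>)"

definition partial_sum :: "(nat \<Rightarrow> 'a \<Rightarrow> real) \<Rightarrow> nat \<Rightarrow> 'a \<Rightarrow> real" where
  "partial_sum X n \<omega> = (\<Sum>i=1..n. X i \<omega>)"

text \<open>Only meaningful for \<open>n \<ge> 1\<close>.\<close>

definition partial_max :: "(nat \<Rightarrow> 'a \<Rightarrow> real) \<Rightarrow> nat \<Rightarrow> 'a \<Rightarrow> real" where
  "partial_max X n \<omega> = Max ((\<lambda>i. X i \<omega>) ` {1..n})"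

text \<open>The law of \<open>Y\<close> under the elementary conditional probability given \<open>A\<close>; a probability
  measure as soon as \<open>A\<close> has positive probability.\<close>

definition cond_law :: "'a measure \<Rightarrow> ('a \<Rightarrow> real) \<Rightarrow> 'a set \<Rightarrow> real measure" where
  "cond_law M Y A = distr (uniform_measure M A) borel Y"

definition two_point_mixture :: "real \<Rightarrow> real \<Rightarrow> real \<Rightarrow> real measure" where
  "two_point_mixture s x y = measure_of UNIV (sets borel)
     (\<lambda>A. ennreal (1 - s) * emeasure (return borel x) A + ennreal s * emeasure (return borel y) A)"

text \<open>Since \<^const>\<open>measure_of\<close> yields the null measure when its argument is not countably
  additive, we record that \<open>two_point_mixture s x y\<close> really is \<open>(1 - s) \<delta>\<^sub>x + s \<delta>\<^sub>y\<close>.\<close>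

lemma sets_two_point_mixture [simp]: "sets (two_point_mixture s x y) = sets borel"
  unfolding two_point_mixture_def
  by (metis sets.sets_measure_of_eq space_borel)

lemma emeasure_two_point_mixture:
  assumes "A \<in> sets borel"
  shows "emeasure (two_point_mixture s x y) A =
    ennreal (1 - s) * indicator A x + ennreal s * indicator A y"
proof -
  let ?f = "\<lambda>A. ennreal (1 - s) * emeasure (return borel x) A
                + ennreal s * emeasure (return borel y) A"
  have "emeasure (two_point_mixture s x y) A = ?f A"
  proof (rule emeasure_measure_of[OF two_point_mixture_def])
    show "countably_additive (sets (two_point_mixture s x y)) ?f"
    proof (rule countably_additiveI)
      fix B :: "nat \<Rightarrow> real set"
      assume B: "range B \<subseteq> sets (two_point_mixture s x y)" "disjoint_family B"
      have "(\<Sum>i. ?f (B i)) = ennreal (1 - s) * (\<Sum>i. emeasure (return borel x) (B i))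
          + ennreal s * (\<Sum>i. emeasure (return borel y) (B i))"
        by (simp add: suminf_add[symmetric])
      also have "\<dots> = ?f (\<Union>i. B i)"
        using B suminf_emeasure[of B "return borel x"] suminf_emeasure[of B "return borel y"]
        by (simp del: emeasure_return)
      finally show "(\<Sum>i. ?f (B i)) = ?f (\<Union>i. B i)" .
    qed
  qed (use assms in \<open>auto simp: positive_def\<close>)
  then show ?thesis using assms by simp
qed

end

theory Submission
  imports Defs
begin

text \<open>Write \<open>T\<close> for the centred sum, \<open>R\<^sub>i = T - X i\<close> and \<open>x = x n\<close>. Since \<open>x\<close> is of larger order
  than \<open>a n\<close>, slow variation of the truncated variance makes \<open>R\<^sub>i / x\<close> small in probability,
  uniformly in \<open>i\<close>, and \<open>R\<^sub>i\<close> is independent of \<open>X i\<close>. Hence for \<open>u > 0\<close>, up to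
  \<open>o(n tail(x))\<close>, the event \<open>T \<ge> x, max > u T\<close> happens only through a summand \<open>X i > u T\<close> whose
  remainder \<open>R\<^sub>i\<close> is at most \<open>\<eta> x\<close>. Such a summand is roughly equal to \<open>T\<close>: this is impossible if
  \<open>u > 1\<close>, and if \<open>u < 1\<close> it amounts to \<open>X i\<close> exceeding roughly \<open>x\<close>, which by intermediate regular
  variation has total probability asymptotic to \<open>n tail(x)\<close>. Dividing by \<open>P(T \<ge> x)\<close>, the conditional
  law puts asymptotic mass \<open>s\<close> near \<open>1\<close> and the rest near \<open>0\<close>.\<close>

section \<open>Truncated moments and a weak law\<close>

text \<open>The constant \<open>3 / 2 < 2\<close> makes the contributions of the dyadic shells
  \<open>2 ^ k z < \<bar>Y\<bar> \<le> 2 ^ Suc k z\<close> summable.\<close>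

lemma integral_abs_gt_le:
  fixes Y :: "'a \<Rightarrow> real"
  assumes int: "integrable M Y"
    and z: "0 < z" "z0 \<le> z"
    and doubling: "\<And>y. z0 \<le> y \<Longrightarrow>
      (\<integral>\<omega>. (Y \<omega>)\<^sup>2 * indicator {\<omega>. \<bar>Y \<omega>\<bar> \<le> 2 * y} \<omega> \<partial>M)
        \<le> 3 / 2 * (\<integral>\<omega>. (Y \<omega>)\<^sup>2 * indicator {\<omega>. \<bar>Y \<omega>\<bar> \<le> y} \<omega> \<partial>M)"
  shows "(\<integral>\<omega>. \<bar>Y \<omega>\<bar> * indicator {\<omega>. z < \<bar>Y \<omega>\<bar>} \<omega> \<partial>M)
    \<le> 6 * (\<integral>\<omega>. (Y \<omega>)\<^sup>2 * indicator {\<omega>. \<bar>Y \<omega>\<bar> \<le> z} \<omega> \<partial>M) / z"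
proof -
  define V where "V y = (\<integral>\<omega>. (Y \<omega>)\<^sup>2 * indicator {\<omega>. \<bar>Y \<omega>\<bar> \<le> y} \<omega> \<partial>M)" for y
  have [measurable]: "Y \<in> borel_measurable M" using int by auto
  have intsq: "integrable M (\<lambda>\<omega>. (Y \<omega>)\<^sup>2 * indicator {\<omega>. \<bar>Y \<omega>\<bar> \<le> y} \<omega>)" for y
  \<comment> \<open>The measure may be infinite, so a constant bound would not do; on the truncation
    set the square is dominated by a multiple of the integrable
    \<open>\<bar>Y\<bar>\<close>.\<close>
  proof (rule Bochner_Integration.integrable_bound[OF integrable_mult_right[OF integrable_abs[OF int], of "\<bar>y\<bar>"]])
    show "AE \<omega> in M. norm ((Y \<omega>)\<^sup>2 * indicator {\<omega>. \<bar>Y \<omega>\<bar> \<le> y} \<omega>) \<le> norm (\<bar>y\<bar> * \<bar>Y \<omega>\<bar>)"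
    proof (rule AE_I2)
      fix \<omega>
      have "\<bar>Y \<omega>\<bar> * \<bar>Y \<omega>\<bar> \<le> \<bar>y\<bar> * \<bar>Y \<omega>\<bar>" if "\<bar>Y \<omega>\<bar> \<le> y"
        using that by (intro mult_right_mono) auto
      then show "norm ((Y \<omega>)\<^sup>2 * indicator {\<omega>. \<bar>Y \<omega>\<bar> \<le> y} \<omega>) \<le> norm (\<bar>y\<bar> * \<bar>Y \<omega>\<bar>)"
        by (auto simp: indicator_def power2_eq_square abs_mult)
    qed
  qed measurable
  have V0: "0 \<le> V y" for y unfolding V_def by (intro integral_nonneg_AE AE_I2) auto
  have V_pow: "V (2 ^ k * z) \<le> (3 / 2) ^ k * V z" for k :: nat
  proof (induction k)
    case (Suc k)
    have "z * 1 \<le> z * 2 ^ k" using z by (intro mult_left_mono) auto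
    then have "z0 \<le> 2 ^ k * z" using z(2) mult.commute[of z "2 ^ k"] by linarith
    then have "V (2 * (2 ^ k * z)) \<le> 3 / 2 * V (2 ^ k * z)"
      unfolding V_def by (rule doubling)
    with Suc show ?case by (simp add: mult.assoc)
  qed simp
  \<comment> \<open>Cutting off from above at \<open>2 ^ N * z\<close> lets an induction add one
    dyadic shell at a time.\<close>
  define W where "W N = (\<integral>\<omega>. \<bar>Y \<omega>\<bar> * indicator {\<omega>. z < \<bar>Y \<omega>\<bar> \<and> \<bar>Y \<omega>\<bar> \<le> 2 ^ N * z} \<omega> \<partial>M)" for N :: nat
  have intW: "integrable M (\<lambda>\<omega>. \<bar>Y \<omega>\<bar> * indicator {\<omega>. z < \<bar>Y \<omega>\<bar> \<and> \<bar>Y \<omega>\<bar> \<le> y} \<omega>)" for y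
    by (rule Bochner_Integration.integrable_bound[OF integrable_abs[OF int]]) (auto simp: indicator_def)
  \<comment> \<open>The factor \<open>6 * (1 - (3 / 4) ^ N)\<close> is the geometric sum of
    \<open>3 / 2 * (3 / 4) ^ k\<close> over \<open>k < N\<close>: the shell from
    \<open>2 ^ k * z\<close> to \<open>2 ^ Suc k * z\<close> contributes at most
    \<open>V (2 ^ Suc k * z) / (2 ^ k * z)\<close>, where \<open>V\<close> has grown by
    \<open>(3 / 2) ^ Suc k\<close>.\<close>
  have W: "W N \<le> 6 * (1 - (3 / 4) ^ N) * V z / z" for N
  proof (induction N)
    case 0
    have "indicator {\<omega>. z < \<bar>Y \<omega>\<bar> \<and> \<bar>Y \<omega>\<bar> \<le> 2 ^ 0 * z} = (\<lambda>_. 0 :: real)" by (auto simp: indicator_def fun_eq_iff)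
    then show ?case by (simp add: W_def)
  next
    case (Suc N)
    have zN: "0 < 2 ^ N * z" using z by simp
    \<comment> \<open>On the new shell \<open>\<bar>Y\<bar>\<close> exceeds
      \<open>2 ^ N * z\<close>, hence is at most its square divided by that level.\<close>
    have "W (Suc N) \<le> (\<integral>\<omega>. \<bar>Y \<omega>\<bar> * indicator {\<omega>. z < \<bar>Y \<omega>\<bar> \<and> \<bar>Y \<omega>\<bar> \<le> 2 ^ N * z} \<omega>
        + ((Y \<omega>)\<^sup>2 * indicator {\<omega>. \<bar>Y \<omega>\<bar> \<le> 2 ^ Suc N * z} \<omega>) / (2 ^ N * z) \<partial>M)"
      unfolding W_def
    proof (intro integral_mono intW Bochner_Integration.integrable_add integrable_divide intsq)
      fix \<omega>
      have "\<bar>Y \<omega>\<bar> \<le> (Y \<omega>)\<^sup>2 / (2 ^ N * z)" if "2 ^ N * z < \<bar>Y \<omega>\<bar>"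
      proof -
        have "\<bar>Y \<omega>\<bar> * (2 ^ N * z) \<le> \<bar>Y \<omega>\<bar> * \<bar>Y \<omega>\<bar>" using that by (intro mult_left_mono) auto
        then show ?thesis using zN by (simp add: power2_eq_square le_divide_eq)
      qed
      then show "\<bar>Y \<omega>\<bar> * indicator {\<omega>. z < \<bar>Y \<omega>\<bar> \<and> \<bar>Y \<omega>\<bar> \<le> 2 ^ Suc N * z} \<omega>
        \<le> \<bar>Y \<omega>\<bar> * indicator {\<omega>. z < \<bar>Y \<omega>\<bar> \<and> \<bar>Y \<omega>\<bar> \<le> 2 ^ N * z} \<omega>
        + ((Y \<omega>)\<^sup>2 * indicator {\<omega>. \<bar>Y \<omega>\<bar> \<le> 2 ^ Suc N * z} \<omega>) / (2 ^ N * z)"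
        using zN by (cases "2 ^ N * z < \<bar>Y \<omega>\<bar>") (auto simp: indicator_def)
    qed
    also have "\<dots> = W N + V (2 ^ Suc N * z) / (2 ^ N * z)"
      unfolding W_def V_def by (subst Bochner_Integration.integral_add) (auto intro!: intW integrable_divide intsq)
    also have "V (2 ^ Suc N * z) / (2 ^ N * z) \<le> (3 / 2) ^ Suc N * V z / (2 ^ N * z)"
      using V_pow[of "Suc N"] zN by (intro divide_right_mono) auto
    also have "\<dots> = 3 / 2 * (3 / 4) ^ N * V z / z"
    proof -
      have "(3 / 2 :: real) ^ N = (3 / 4) ^ N * 2 ^ N" by (simp add: power_mult_distrib[symmetric])
      then show ?thesis using z by (simp add: field_simps)
    qed
    also have "W N + 3 / 2 * (3 / 4) ^ N * V z / z \<le> 6 * (1 - (3 / 4) ^ N) * V z / z + 3 / 2 * (3 / 4) ^ N * V z / z"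
      using Suc by simp
    also have "\<dots> = 6 * (1 - (3 / 4) ^ Suc N) * V z / z"
      using z by (simp add: field_simps)
    finally show ?case by simp
  qed
  have "W \<longlonglongrightarrow> (\<integral>\<omega>. \<bar>Y \<omega>\<bar> * indicator {\<omega>. z < \<bar>Y \<omega>\<bar>} \<omega> \<partial>M)"
    unfolding W_def
  proof (rule integral_dominated_convergence[OF _ _ integrable_abs[OF int]])
    show "AE \<omega> in M. (\<lambda>N. \<bar>Y \<omega>\<bar> * indicator {\<omega>. z < \<bar>Y \<omega>\<bar> \<and> \<bar>Y \<omega>\<bar> \<le> 2 ^ N * z} \<omega>)
        \<longlonglongrightarrow> \<bar>Y \<omega>\<bar> * indicator {\<omega>. z < \<bar>Y \<omega>\<bar>} \<omega>"
    proof (rule AE_I2, rule tendsto_eventually)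
      fix \<omega>
      obtain N0 where "\<bar>Y \<omega>\<bar> / z < 2 ^ N0" using real_arch_pow[of 2] by auto
      then have N0: "\<bar>Y \<omega>\<bar> \<le> 2 ^ N0 * z" using z by (simp add: field_simps)
      have "\<bar>Y \<omega>\<bar> \<le> 2 ^ N * z" if "N \<ge> N0" for N
      proof -
        have "2 ^ N0 * z \<le> 2 ^ N * z" using that z by (intro mult_right_mono power_increasing) auto
        with N0 show ?thesis by simp
      qed
      then show "\<forall>\<^sub>F N in sequentially. \<bar>Y \<omega>\<bar> * indicator {\<omega>. z < \<bar>Y \<omega>\<bar> \<and> \<bar>Y \<omega>\<bar> \<le> 2 ^ N * z} \<omega>
        = \<bar>Y \<omega>\<bar> * indicator {\<omega>. z < \<bar>Y \<omega>\<bar>} \<omega>"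
        unfolding eventually_sequentially by (intro exI[of _ N0]) (auto simp: indicator_def)
    qed
  qed (auto simp: indicator_def)
  moreover have "W N \<le> 6 * V z / z" for N
  proof -
    have "6 * (1 - (3 / 4) ^ N) * V z / z \<le> 6 * 1 * V z / z"
      using z V0[of z] by (intro divide_right_mono mult_right_mono mult_left_mono) auto
    with W[of N] show ?thesis by simp
  qed
  ultimately show ?thesis unfolding V_def by (intro LIMSEQ_le_const2) auto
qed

text \<open>Truncation destroys exact centring, so the squared mean has to be carried along with the
  variance. In the induction the cross term factorises by independence into at most
  \<open>2 * m * (card J * m)\<close>, which fits into the increase of
  \<open>(card J * m)\<^sup>2\<close>.\<close>

lemma (in prob_space) second_moment_sum_indep_le:
  fixes U :: "'i \<Rightarrow> 'a \<Rightarrow> real" and m v :: real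
  assumes "finite J" "indep_vars (\<lambda>_. borel) U J"
    and "\<And>j. j \<in> J \<Longrightarrow> integrable M (\<lambda>\<omega>. (U j \<omega>)\<^sup>2)"
    and "\<And>j. j \<in> J \<Longrightarrow> \<bar>expectation (U j)\<bar> \<le> m"
    and "\<And>j. j \<in> J \<Longrightarrow> expectation (\<lambda>\<omega>. (U j \<omega>)\<^sup>2) \<le> v"
  shows "integrable M (\<lambda>\<omega>. (\<Sum>j\<in>J. U j \<omega>)\<^sup>2) \<and>
    expectation (\<lambda>\<omega>. (\<Sum>j\<in>J. U j \<omega>)\<^sup>2) \<le> card J * v + (card J * m)\<^sup>2"
  using assms
proof (induction J rule: finite_induct)
  case (insert i J)
  define S where "S \<omega> = (\<Sum>j\<in>J. U j \<omega>)" for \<omega>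
  have ind: "indep_vars (\<lambda>_. borel) U J"
    using insert.prems(1) by (rule indep_vars_subset) auto
  have IH: "integrable M (\<lambda>\<omega>. (S \<omega>)\<^sup>2)" "expectation (\<lambda>\<omega>. (S \<omega>)\<^sup>2) \<le> card J * v + (card J * m)\<^sup>2"
    using insert.IH[OF ind] insert.prems unfolding S_def by auto
  have meas: "U j \<in> borel_measurable M" if "j \<in> insert i J" for j
    using insert.prems(1) that by (auto simp: indep_vars_def2)
  have intU: "integrable M (U j)" if "j \<in> insert i J" for j
    using square_integrable_imp_integrable[OF meas[OF that]] insert.prems(2)[OF that] by simp
  have intS: "integrable M S" unfolding S_def using intU by auto
  have ES: "\<bar>expectation S\<bar> \<le> card J * m"
  proof -
    have "expectation S = (\<Sum>j\<in>J. expectation (U j))"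
      unfolding S_def using intU by (intro Bochner_Integration.integral_sum) auto
    also have "\<bar>\<dots>\<bar> \<le> (\<Sum>j\<in>J. \<bar>expectation (U j)\<bar>)" by (rule sum_abs)
    also have "\<dots> \<le> card J * m" using insert.prems(3) by (intro sum_bounded_above) auto
    finally show ?thesis .
  qed
  have indep: "indep_var borel (U i) borel S"
    unfolding S_def using insert by (intro indep_vars_sum) auto
  have prod: "integrable M (\<lambda>\<omega>. U i \<omega> * S \<omega>)"
    "expectation (\<lambda>\<omega>. U i \<omega> * S \<omega>) = expectation (U i) * expectation S"
    using indep_var_integrable[OF indep] indep_var_lebesgue_integral[OF indep] intU intS by auto
  have eq: "(\<Sum>j\<in>insert i J. U j \<omega>)\<^sup>2 = (U i \<omega>)\<^sup>2 + 2 * (U i \<omega> * S \<omega>) + (S \<omega>)\<^sup>2" for \<omega>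
    using insert.hyps by (simp add: S_def power2_sum)
  have int: "integrable M (\<lambda>\<omega>. (\<Sum>j\<in>insert i J. U j \<omega>)\<^sup>2)"
    unfolding eq using prod IH insert.prems(2) by auto
  have m0: "0 \<le> m" using insert.prems(3)[of i] by auto
  have "expectation (U i) * expectation S \<le> m * (card J * m)"
  proof -
    have "\<bar>expectation (U i)\<bar> * \<bar>expectation S\<bar> \<le> m * (card J * m)"
      using ES insert.prems(3)[of i] m0 by (intro mult_mono) auto
    then show ?thesis unfolding abs_mult[symmetric] by simp
  qed
  moreover have "expectation (\<lambda>\<omega>. (\<Sum>j\<in>insert i J. U j \<omega>)\<^sup>2) =
      expectation (\<lambda>\<omega>. (U i \<omega>)\<^sup>2) + 2 * (expectation (U i) * expectation S) + expectation (\<lambda>\<omega>. (S \<omega>)\<^sup>2)"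
    unfolding eq prod(2)[symmetric] using prod(1) IH insert.prems(2) by (simp add: Bochner_Integration.integral_add)
  ultimately have "expectation (\<lambda>\<omega>. (\<Sum>j\<in>insert i J. U j \<omega>)\<^sup>2) \<le> v + 2 * (m * (card J * m)) + (card J * v + (card J * m)\<^sup>2)"
    using IH insert.prems(4)[of i] by auto
  also have "\<dots> \<le> card (insert i J) * v + (card (insert i J) * m)\<^sup>2"
    using insert.hyps by (simp add: power2_eq_square algebra_simps)
  finally show ?case using int by simp
qed simp

text \<open>Each summand is split at level \<open>z\<close>, and each of the two resulting sums is
  allowed half of \<open>\<epsilon>\<close>. Markov's inequality controls the large parts through
  their absolute first moments, and the truncated parts through the second moment of their sum. No
  finite variance is required.\<close>

lemma (in prob_space) prob_abs_sum_gt_le: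
  fixes Z :: "'i \<Rightarrow> 'a \<Rightarrow> real" and v w \<epsilon> z :: real
  assumes J: "finite J" and ind: "indep_vars (\<lambda>_. borel) Z J"
    and int: "\<And>j. j \<in> J \<Longrightarrow> integrable M (Z j)"
    and mean0: "\<And>j. j \<in> J \<Longrightarrow> expectation (Z j) = 0"
    and v: "\<And>j. j \<in> J \<Longrightarrow> expectation (\<lambda>\<omega>. (Z j \<omega>)\<^sup>2 * indicator {\<omega>. \<bar>Z j \<omega>\<bar> \<le> z} \<omega>) \<le> v"
    and w: "\<And>j. j \<in> J \<Longrightarrow> expectation (\<lambda>\<omega>. \<bar>Z j \<omega>\<bar> * indicator {\<omega>. z < \<bar>Z j \<omega>\<bar>} \<omega>) \<le> w"
    and \<epsilon>: "0 < \<epsilon>" and z: "0 < z"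
  shows "prob {\<omega> \<in> space M. \<epsilon> < \<bar>\<Sum>j\<in>J. Z j \<omega>\<bar>}
    \<le> 2 * (card J * w) / \<epsilon> + 4 * (card J * v + (card J * w)\<^sup>2) / \<epsilon>\<^sup>2"
proof -
  \<comment> \<open>The indicators act on values, so that \<open>U j\<close> is a Borel function of
    \<open>Z j\<close> and inherits independence.\<close>
  define U where "U j \<omega> = Z j \<omega> * indicator {y. \<bar>y\<bar> \<le> z} (Z j \<omega>)" for j \<omega>
  define L where "L j \<omega> = Z j \<omega> * indicator {y. z < \<bar>y\<bar>} (Z j \<omega>)" for j \<omega>
  have Z_meas[measurable]: "Z j \<in> borel_measurable M" if "j \<in> J" for j
    using ind that by (auto simp: indep_vars_def2)
  have U_meas[measurable]: "U j \<in> borel_measurable M" if "j \<in> J" for j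
    unfolding U_def using that by measurable
  have L_meas[measurable]: "L j \<in> borel_measurable M" if "j \<in> J" for j
    unfolding L_def using that by measurable
  have UL: "Z j \<omega> = U j \<omega> + L j \<omega>" for j \<omega> by (auto simp: U_def L_def indicator_def)
  have intU: "integrable M (U j)" and intL: "integrable M (L j)" if "j \<in> J" for j
    using that by (auto intro!: Bochner_Integration.integrable_bound[OF int[OF that]] simp: U_def L_def indicator_def)
  have L1: "expectation (\<lambda>\<omega>. \<bar>L j \<omega>\<bar>) \<le> w" if "j \<in> J" for j
  proof -
    have "(\<lambda>\<omega>. \<bar>L j \<omega>\<bar>) = (\<lambda>\<omega>. \<bar>Z j \<omega>\<bar> * indicator {\<omega>. z < \<bar>Z j \<omega>\<bar>} \<omega>)"
      by (auto simp: L_def indicator_def fun_eq_iff)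
    then show ?thesis using w[OF that] by simp
  qed
  \<comment> \<open>Since \<open>Z j\<close> is centred, the mean of the truncated part is minus the
    mean of the large part.\<close>
  have EU: "\<bar>expectation (U j)\<bar> \<le> w" if "j \<in> J" for j
  proof -
    have "0 = expectation (U j) + expectation (L j)"
      using mean0[OF that] intU[OF that] intL[OF that] by (simp add: UL[abs_def])
    moreover have "\<bar>expectation (L j)\<bar> \<le> expectation (\<lambda>\<omega>. \<bar>L j \<omega>\<bar>)" by simp
    ultimately show ?thesis using L1[OF that] by linarith
  qed
  have U2eq: "(\<lambda>\<omega>. (U j \<omega>)\<^sup>2) = (\<lambda>\<omega>. (Z j \<omega>)\<^sup>2 * indicator {\<omega>. \<bar>Z j \<omega>\<bar> \<le> z} \<omega>)" for j
    by (auto simp: U_def indicator_def fun_eq_iff)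
  have U2: "integrable M (\<lambda>\<omega>. (U j \<omega>)\<^sup>2)" if "j \<in> J" for j
  proof (rule integrable_const_bound[where B = "z\<^sup>2"])
    have "(U j \<omega>)\<^sup>2 \<le> z\<^sup>2" for \<omega>
      using z by (auto simp: U_def indicator_def abs_le_square_iff[symmetric])
    then show "AE \<omega> in M. norm ((U j \<omega>)\<^sup>2) \<le> z\<^sup>2" by simp
  qed (use that in measurable)
  have indU: "indep_vars (\<lambda>_. borel) U J"
    unfolding U_def[abs_def]
    by (rule indep_vars_compose2[OF ind, where Y = "\<lambda>_ y. y * indicator {y. \<bar>y\<bar> \<le> z} y"]) measurable
  have sm: "integrable M (\<lambda>\<omega>. (\<Sum>j\<in>J. U j \<omega>)\<^sup>2)"
    "expectation (\<lambda>\<omega>. (\<Sum>j\<in>J. U j \<omega>)\<^sup>2) \<le> card J * v + (card J * w)\<^sup>2"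
    using second_moment_sum_indep_le[OF J indU U2 EU, of v] v by (auto simp: U2eq)
  have intSL: "integrable M (\<lambda>\<omega>. \<Sum>j\<in>J. \<bar>L j \<omega>\<bar>)" using intL by auto
  have SL: "expectation (\<lambda>\<omega>. \<Sum>j\<in>J. \<bar>L j \<omega>\<bar>) \<le> card J * w"
    using L1 intL by (subst Bochner_Integration.integral_sum) (auto intro!: sum_bounded_above)
  have "prob {\<omega> \<in> space M. \<epsilon> < \<bar>\<Sum>j\<in>J. Z j \<omega>\<bar>}
    \<le> prob ({\<omega> \<in> space M. (\<Sum>j\<in>J. \<bar>L j \<omega>\<bar>) \<ge> \<epsilon> / 2} \<union> {\<omega> \<in> space M. (\<Sum>j\<in>J. U j \<omega>)\<^sup>2 \<ge> (\<epsilon> / 2)\<^sup>2})"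
  proof (rule finite_measure_mono)
    show "{\<omega> \<in> space M. \<epsilon> < \<bar>\<Sum>j\<in>J. Z j \<omega>\<bar>} \<subseteq>
      {\<omega> \<in> space M. (\<Sum>j\<in>J. \<bar>L j \<omega>\<bar>) \<ge> \<epsilon> / 2} \<union> {\<omega> \<in> space M. (\<Sum>j\<in>J. U j \<omega>)\<^sup>2 \<ge> (\<epsilon> / 2)\<^sup>2}"
    proof safe
      fix \<omega> assume a: "\<epsilon> < \<bar>\<Sum>j\<in>J. Z j \<omega>\<bar>" "\<not> (\<epsilon> / 2)\<^sup>2 \<le> (\<Sum>j\<in>J. U j \<omega>)\<^sup>2"
      have "\<bar>\<Sum>j\<in>J. U j \<omega>\<bar> < \<epsilon> / 2"
        using a(2) \<epsilon> abs_le_square_iff[of "\<epsilon> / 2" "\<Sum>j\<in>J. U j \<omega>"] by auto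
      moreover have "\<bar>\<Sum>j\<in>J. L j \<omega>\<bar> \<le> (\<Sum>j\<in>J. \<bar>L j \<omega>\<bar>)" by (rule sum_abs)
      moreover have "(\<Sum>j\<in>J. Z j \<omega>) = (\<Sum>j\<in>J. U j \<omega>) + (\<Sum>j\<in>J. L j \<omega>)" by (simp add: UL sum.distrib)
      ultimately show "\<epsilon> / 2 \<le> (\<Sum>j\<in>J. \<bar>L j \<omega>\<bar>)" using a(1) by linarith
    qed
  qed measurable
  also have "\<dots> \<le> prob {\<omega> \<in> space M. (\<Sum>j\<in>J. \<bar>L j \<omega>\<bar>) \<ge> \<epsilon> / 2} + prob {\<omega> \<in> space M. (\<Sum>j\<in>J. U j \<omega>)\<^sup>2 \<ge> (\<epsilon> / 2)\<^sup>2}"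
    by (rule measure_Un_le) measurable
  also have "\<dots> \<le> card J * w / (\<epsilon> / 2) + (card J * v + (card J * w)\<^sup>2) / (\<epsilon> / 2)\<^sup>2"
  proof (rule add_mono)
    have "prob {\<omega> \<in> space M. (\<Sum>j\<in>J. \<bar>L j \<omega>\<bar>) \<ge> \<epsilon> / 2} \<le> expectation (\<lambda>\<omega>. \<Sum>j\<in>J. \<bar>L j \<omega>\<bar>) / (\<epsilon> / 2)"
      using \<epsilon> by (intro integral_Markov_inequality_measure[OF intSL sets.top]) (auto intro: sum_nonneg)
    also have "\<dots> \<le> card J * w / (\<epsilon> / 2)" using SL \<epsilon> by (intro divide_right_mono) auto
    finally show "prob {\<omega> \<in> space M. (\<Sum>j\<in>J. \<bar>L j \<omega>\<bar>) \<ge> \<epsilon> / 2} \<le> card J * w / (\<epsilon> / 2)" .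
    have "prob {\<omega> \<in> space M. (\<Sum>j\<in>J. U j \<omega>)\<^sup>2 \<ge> (\<epsilon> / 2)\<^sup>2} \<le> expectation (\<lambda>\<omega>. (\<Sum>j\<in>J. U j \<omega>)\<^sup>2) / (\<epsilon> / 2)\<^sup>2"
      using \<epsilon> by (intro integral_Markov_inequality_measure[OF sm(1) sets.top]) auto
    also have "\<dots> \<le> (card J * v + (card J * w)\<^sup>2) / (\<epsilon> / 2)\<^sup>2" using sm(2) by (intro divide_right_mono) auto
    finally show "prob {\<omega> \<in> space M. (\<Sum>j\<in>J. U j \<omega>)\<^sup>2 \<ge> (\<epsilon> / 2)\<^sup>2} \<le> (card J * v + (card J * w)\<^sup>2) / (\<epsilon> / 2)\<^sup>2" .
  qed
  also have "\<dots> = 2 * (card J * w) / \<epsilon> + 4 * (card J * v + (card J * w)\<^sup>2) / \<epsilon>\<^sup>2"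
    by (simp add: power_divide field_simps)
  finally show ?thesis .
qed

section \<open>Intermediate regular variation\<close>

text \<open>This is the form in which the liminf condition enters the jump estimates: a sufficiently
  small dilation costs at most the factor \<open>1 - \<epsilon>\<close>.\<close>

lemma intermediate_regularly_varyingD:
  fixes \<epsilon> :: real
  assumes irv: "intermediate_regularly_varying f" and \<epsilon>: "0 < \<epsilon>"
  obtains l0 where "1 < l0"
    "\<And>l. 1 < l \<Longrightarrow> l < l0 \<Longrightarrow> \<forall>\<^sub>F y in at_top. (1 - \<epsilon>) * f y \<le> f (l * y)"
proof -
  have pos: "\<forall>\<^sub>F y in at_top. 0 < f y"
    and lim: "((\<lambda>l. Liminf at_top (\<lambda>y. ereal (f (l * y) / f y))) \<longlongrightarrow> 1) (at_right 1)"
    using irv by (auto simp: intermediate_regularly_varying_def)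
  have "\<forall>\<^sub>F l in at_right 1. ereal (1 - \<epsilon>) < Liminf at_top (\<lambda>y. ereal (f (l * y) / f y))"
    using \<epsilon> by (intro order_tendstoD(1)[OF lim]) (simp add: one_ereal_def)
  then obtain l0 where l0: "1 < l0"
    "\<And>l. 1 < l \<Longrightarrow> l < l0 \<Longrightarrow> ereal (1 - \<epsilon>) < Liminf at_top (\<lambda>y. ereal (f (l * y) / f y))"
    by (auto simp: eventually_at_right_field)
  have "\<forall>\<^sub>F y in at_top. (1 - \<epsilon>) * f y \<le> f (l * y)" if "1 < l" "l < l0" for l
    using less_LiminfD[OF l0(2)[OF that]] pos
  proof eventually_elim
    case (elim y)
    then show ?case by (simp add: less_divide_eq)
  qed
  with l0(1) show ?thesis using that by blast
qed

text \<open>Dilating by a fixed \<open>l > 1\<close> loses at most a factor 2. After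
  \<open>k\<close> iterations with \<open>l ^ k > c\<close> monotonicity replaces
  \<open>l ^ k\<close> by \<open>c\<close>, at total cost \<open>K = 2 ^ k\<close>. This compares
  the tail at \<open>u * x n\<close> with the tail at \<open>x n\<close> even for small
  \<open>u\<close>.\<close>

lemma intermediate_regularly_varying_dominated:
  fixes c :: real
  assumes irv: "intermediate_regularly_varying f" and anti: "antimono f"
  obtains K where "0 < K" "\<forall>\<^sub>F y in at_top. f y \<le> K * f (c * y)"
proof -
  obtain l0 where l0: "1 < l0"
    "\<And>l. 1 < l \<Longrightarrow> l < l0 \<Longrightarrow> \<forall>\<^sub>F y in at_top. (1 - 1 / 2) * f y \<le> f (l * y)"
    by (rule intermediate_regularly_varyingD[OF irv, of "1 / 2"]) auto
  obtain l where l: "1 < l" "l < l0" using l0(1) dense by blast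
  have ev: "\<forall>\<^sub>F y in at_top. f y \<le> 2 ^ k * f (l ^ k * y)" for k :: nat
  proof (induction k)
    case (Suc k)
    have "filterlim (\<lambda>y. l ^ k * y) at_top at_top"
      using l by (intro filterlim_tendsto_pos_mult_at_top[OF tendsto_const]) (auto simp: filterlim_ident)
    then have "\<forall>\<^sub>F y in at_top. (1 - 1 / 2) * f (l ^ k * y) \<le> f (l * (l ^ k * y))"
      using l0(2)[OF l] by (auto simp: filterlim_iff)
    with Suc show ?case
    proof eventually_elim
      case (elim y)
      have "2 ^ k * f (l ^ k * y) \<le> 2 ^ k * (2 * f (l * (l ^ k * y)))"
        using elim(2) by (intro mult_left_mono) auto
      also have "\<dots> = 2 ^ Suc k * f (l ^ Suc k * y)" by (simp add: mult.assoc)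
      finally show ?case using elim(1) by linarith
    qed
  qed simp
  obtain k where k: "c < l ^ k" using real_arch_pow[OF l(1)] by auto
  have "\<forall>\<^sub>F y in at_top. f y \<le> 2 ^ k * f (c * y)"
    using ev[of k] eventually_ge_at_top[of 0]
  proof eventually_elim
    case (elim y)
    have "f (l ^ k * y) \<le> f (c * y)" using anti k elim by (intro antimonoD[OF anti] mult_right_mono) auto
    then have "2 ^ k * f (l ^ k * y) \<le> 2 ^ k * f (c * y)" by (intro mult_left_mono) auto
    with elim show ?case by linarith
  qed
  then show ?thesis by (intro that[of "2 ^ k"]) auto
qed

section \<open>One big jump\<close>

lemma (in prob_space) one_minus_cdf_distr:
  assumes [measurable]: "Y \<in> borel_measurable M"
  shows "1 - cdf (distr M borel Y) y = prob {\<omega> \<in> space M. y < Y \<omega>}"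
proof -
  have "cdf (distr M borel Y) y = prob {\<omega> \<in> space M. Y \<omega> \<le> y}"
    unfolding cdf_def by (subst measure_distr) (auto intro!: arg_cong[where f = prob])
  also have "1 - \<dots> = prob (space M - {\<omega> \<in> space M. Y \<omega> \<le> y})"
    by (subst prob_compl) auto
  also have "space M - {\<omega> \<in> space M. Y \<omega> \<le> y} = {\<omega> \<in> space M. y < Y \<omega>}" by auto
  finally show ?thesis .
qed

text \<open>These assumptions isolate what the jump argument takes from the domain of attraction.
  The weak law is uniform over index sets \<open>J\<close> so that it covers every sum with one
  summand left out.\<close>

locale one_big_jump = prob_space M
  for M :: "'a measure" and \<xi> :: "'a \<Rightarrow> real" and X :: "nat \<Rightarrow> 'a \<Rightarrow> real" and x :: "nat \<Rightarrow> real" +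
  assumes iid: "iid_copies M \<xi> X"
    and irv: "intermediate_regularly_varying (tail M \<xi>)"
    and x_lim: "filterlim x at_top sequentially"
    and tail_small: "(\<lambda>n. real n * tail M \<xi> (x n)) \<longlonglongrightarrow> 0"
    and weak_law: "0 < \<eta> \<Longrightarrow> 0 < \<delta> \<Longrightarrow> \<forall>\<^sub>F n in sequentially. \<forall>J\<subseteq>{1..n}.
      prob {\<omega> \<in> space M. \<eta> * x n < \<bar>\<Sum>j\<in>J. X j \<omega> - mean M \<xi>\<bar>} \<le> \<delta>"
begin

abbreviation t :: "real \<Rightarrow> real" where "t \<equiv> tail M \<xi>"

definition T :: "nat \<Rightarrow> 'a \<Rightarrow> real" where
  "T n \<omega> = partial_sum X n \<omega> - real n * mean M \<xi>"

text \<open>The centring uses all \<open>n\<close> means although only \<open>n - 1\<close> summands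
  remain, so that the centred sum is exactly \<open>X i\<close> plus this remainder.\<close>

definition R :: "nat \<Rightarrow> nat \<Rightarrow> 'a \<Rightarrow> real" where
  "R n i \<omega> = (\<Sum>j\<in>{1..n} - {i}. X j \<omega>) - real n * mean M \<xi>"

text \<open>For \<open>x n > 0\<close> the first condition says that the ratio of maximum to centred
  sum exceeds \<open>u\<close>, with the denominator multiplied out. Dividing by the probability of
  the conditioning event gives the upper tail of the conditional law.\<close>

definition jump_prob :: "nat \<Rightarrow> real \<Rightarrow> real" where
  "jump_prob n u = prob {\<omega> \<in> space M. u * T n \<omega> < partial_max X n \<omega> \<and> x n \<le> T n \<omega>}"

lemma indep: "indep_vars (\<lambda>_. borel) X {1..}"
  using iid by (auto simp: iid_copies_def)

lemma X_meas [measurable]: "1 \<le> i \<Longrightarrow> X i \<in> borel_measurable M"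
  using indep by (auto simp: indep_vars_def2)

lemma T_meas [measurable]: "T n \<in> borel_measurable M"
  unfolding T_def[abs_def] partial_sum_def by measurable

lemma R_meas [measurable]: "R n i \<in> borel_measurable M"
  unfolding R_def[abs_def] by measurable

lemma partial_max_meas [measurable]: "1 \<le> n \<Longrightarrow> partial_max X n \<in> borel_measurable M"
  unfolding partial_max_def[abs_def] by (intro borel_measurable_Max) auto

lemma T_eq: "i \<in> {1..n} \<Longrightarrow> T n \<omega> = X i \<omega> + R n i \<omega>"
  by (simp add: T_def R_def partial_sum_def sum.remove[of _ i])

lemma tail_eq: "1 \<le> i \<Longrightarrow> t y = prob {\<omega> \<in> space M. y < X i \<omega>}"
  using iid one_minus_cdf_distr[OF X_meas, of i y] by (simp add: tail_def iid_copies_def)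

lemma tail_nonneg: "0 \<le> t y"
  using tail_eq[of 1 y] by simp

lemma tail_antimono: "antimono t"
proof (rule antimonoI)
  fix y z :: real assume "y \<le> z"
  then show "t z \<le> t y"
    using tail_eq[of 1] by (auto intro!: finite_measure_mono)
qed

lemma prob_jump_indep:
  assumes i: "i \<in> {1..n}" and [measurable]: "B \<in> sets borel"
  shows "prob {\<omega> \<in> space M. y < X i \<omega> \<and> R n i \<omega> \<in> B} = t y * prob {\<omega> \<in> space M. R n i \<omega> \<in> B}"
proof -
  have "indep_var borel (X i) borel (\<lambda>\<omega>. \<Sum>j\<in>{1..n} - {i}. X j \<omega>)"
    using i by (intro indep_vars_sum indep_vars_subset[OF indep]) auto
  from indep_var_compose[OF this, of "\<lambda>y. y" borel "\<lambda>y. y - real n * mean M \<xi>" borel]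
  have "indep_var borel (X i) borel (R n i)" by (simp add: o_def R_def[abs_def])
  from indep_varD[OF this, of "{y<..}" B]
  have "prob ((\<lambda>\<omega>. (X i \<omega>, R n i \<omega>)) -` ({y<..} \<times> B) \<inter> space M)
    = prob (X i -` {y<..} \<inter> space M) * prob (R n i -` B \<inter> space M)" by simp
  moreover have "(\<lambda>\<omega>. (X i \<omega>, R n i \<omega>)) -` ({y<..} \<times> B) \<inter> space M = {\<omega> \<in> space M. y < X i \<omega> \<and> R n i \<omega> \<in> B}"
    "X i -` {y<..} \<inter> space M = {\<omega> \<in> space M. y < X i \<omega>}"
    "R n i -` B \<inter> space M = {\<omega> \<in> space M. R n i \<omega> \<in> B}" by auto
  ultimately show ?thesis using tail_eq[of i y] i by simp
qed

lemma prob_two_jumps: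
  assumes "1 \<le> i" "1 \<le> j" "i \<noteq> j"
  shows "prob {\<omega> \<in> space M. y < X i \<omega> \<and> z < X j \<omega>} = t y * t z"
proof -
  have "indep_var borel (X i) borel (\<lambda>\<omega>. \<Sum>k\<in>{j}. X k \<omega>)"
    using assms by (intro indep_vars_sum indep_vars_subset[OF indep]) auto
  then have "indep_var borel (X i) borel (X j)" by simp
  from indep_varD[OF this, of "{y<..}" "{z<..}"]
  have "prob ((\<lambda>\<omega>. (X i \<omega>, X j \<omega>)) -` ({y<..} \<times> {z<..}) \<inter> space M)
    = prob (X i -` {y<..} \<inter> space M) * prob (X j -` {z<..} \<inter> space M)" by simp
  moreover have "(\<lambda>\<omega>. (X i \<omega>, X j \<omega>)) -` ({y<..} \<times> {z<..}) \<inter> space M = {\<omega> \<in> space M. y < X i \<omega> \<and> z < X j \<omega>}"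
    "X i -` {y<..} \<inter> space M = {\<omega> \<in> space M. y < X i \<omega>}"
    "X j -` {z<..} \<inter> space M = {\<omega> \<in> space M. z < X j \<omega>}" by auto
  ultimately show ?thesis using tail_eq[of i y] tail_eq[of j z] assms by simp
qed

text \<open>The weak law is applied to the other indices with tolerance \<open>\<eta> / 2\<close>.
  The remaining half absorbs the one surplus mean in the centring of \<open>R n i\<close>, which is
  negligible because \<open>x n\<close> tends to infinity.\<close>

lemma rest_small:
  assumes "0 < \<eta>" "0 < \<delta>"
  shows "\<forall>\<^sub>F n in sequentially. \<forall>i\<in>{1..n}. prob {\<omega> \<in> space M. \<eta> * x n < \<bar>R n i \<omega>\<bar>} \<le> \<delta>"
proof -
  have "\<forall>\<^sub>F n in sequentially. 2 * \<bar>mean M \<xi>\<bar> / \<eta> \<le> x n"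
    using x_lim by (simp add: filterlim_at_top)
  moreover have "\<forall>\<^sub>F n in sequentially. \<forall>J\<subseteq>{Suc 0..n}.
      prob {\<omega> \<in> space M. \<eta> * x n < 2 * \<bar>(\<Sum>j\<in>J. X j \<omega>) - card J * mean M \<xi>\<bar>} \<le> \<delta>"
    using weak_law[of "\<eta> / 2" \<delta>] assms by (simp add: sum_subtractf mult.commute[of 2])
  ultimately show ?thesis
  proof (eventually_elim, safe)
    fix n i assume x: "2 * \<bar>mean M \<xi>\<bar> / \<eta> \<le> x n" and i: "i \<in> {1..n}"
      and wl: "\<forall>J\<subseteq>{Suc 0..n}. prob {\<omega> \<in> space M. \<eta> * x n < 2 * \<bar>(\<Sum>j\<in>J. X j \<omega>) - card J * mean M \<xi>\<bar>} \<le> \<delta>"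
    define J where "J = {1..n} - {i}"
    have J: "J \<subseteq> {Suc 0..n}" "real (card J) = real n - 1" using i by (auto simp: J_def)
    have "prob {\<omega> \<in> space M. \<eta> * x n < \<bar>R n i \<omega>\<bar>}
      \<le> prob {\<omega> \<in> space M. \<eta> * x n < 2 * \<bar>(\<Sum>j\<in>J. X j \<omega>) - card J * mean M \<xi>\<bar>}"
    proof (rule finite_measure_mono)
      show "{\<omega> \<in> space M. \<eta> * x n < \<bar>R n i \<omega>\<bar>}
        \<subseteq> {\<omega> \<in> space M. \<eta> * x n < 2 * \<bar>(\<Sum>j\<in>J. X j \<omega>) - card J * mean M \<xi>\<bar>}"
      proof safe
        fix \<omega> assume a: "\<eta> * x n < \<bar>R n i \<omega>\<bar>"
        have "R n i \<omega> = ((\<Sum>j\<in>J. X j \<omega>) - card J * mean M \<xi>) - mean M \<xi>"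
          unfolding R_def J_def[symmetric] J(2) by (simp add: algebra_simps)
        moreover have "2 * \<bar>mean M \<xi>\<bar> \<le> \<eta> * x n" using x assms(1) by (simp add: field_simps)
        moreover have "c < 2 * \<bar>d\<bar>" if "r = d - m" "2 * \<bar>m\<bar> \<le> c" "c < \<bar>r\<bar>" for c d m r :: real
          using that by linarith
        ultimately show "\<eta> * x n < 2 * \<bar>(\<Sum>j\<in>J. X j \<omega>) - card J * mean M \<xi>\<bar>"
          using a by metis
      qed
      have [measurable]: "X j \<in> borel_measurable M" if "j \<in> J" for j using that by (auto simp: J_def)
      show "{\<omega> \<in> space M. \<eta> * x n < 2 * \<bar>(\<Sum>j\<in>J. X j \<omega>) - card J * mean M \<xi>\<bar>} \<in> events"
        by measurable
    qed
    also have "\<dots> \<le> \<delta>" using wl J(1) by blast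
    finally show "prob {\<omega> \<in> space M. \<eta> * x n < \<bar>R n i \<omega>\<bar>} \<le> \<delta>" .
  qed
qed

text \<open>If the maximum exceeds \<open>u * T n\<close>, some summand exceeds
  \<open>u * T n \<ge> u * x n\<close>. When its remainder is large as well, independence bounds the
  probability by a product of two factors, and the sum over \<open>i\<close> is a small multiple of
  \<open>n * t (x n)\<close>. Only jumps with a small remainder are left.\<close>

lemma jump_prob_le:
  assumes "0 < u" "0 < \<eta>" "0 < \<epsilon>"
  shows "\<forall>\<^sub>F n in sequentially. jump_prob n u \<le> \<epsilon> * (real n * t (x n)) +
    (\<Sum>i=1..n. prob {\<omega> \<in> space M. u * T n \<omega> < X i \<omega> \<and> x n \<le> T n \<omega> \<and> \<bar>R n i \<omega>\<bar> \<le> \<eta> * x n})"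
proof -
  \<comment> \<open>Taken at \<open>y = u * x n\<close>, this bounds the tail at
    \<open>u * x n\<close> by \<open>K * t (x n)\<close>; the bound \<open>\<epsilon> / K\<close> on
    the remainder probability then cancels \<open>K\<close>.\<close>
  obtain K where K: "0 < K" "\<forall>\<^sub>F y in at_top. t y \<le> K * t (1 / u * y)"
    by (rule intermediate_regularly_varying_dominated[OF irv tail_antimono])
  have "filterlim (\<lambda>n. u * x n) at_top sequentially"
    using assms by (intro filterlim_tendsto_pos_mult_at_top[OF tendsto_const] x_lim)
  then have "\<forall>\<^sub>F n in sequentially. t (u * x n) \<le> K * t (1 / u * (u * x n))"
    using K(2) unfolding filterlim_iff by blast
  then have Kx: "\<forall>\<^sub>F n in sequentially. t (u * x n) \<le> K * t (x n)" using assms by simp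
  have "\<forall>\<^sub>F n in sequentially. \<forall>i\<in>{1..n}. prob {\<omega> \<in> space M. \<eta> * x n < \<bar>R n i \<omega>\<bar>} \<le> \<epsilon> / K"
    using assms K by (intro rest_small) auto
  with Kx show ?thesis using eventually_ge_at_top[of 1]
  proof eventually_elim
    case (elim n)
    note n = elim(3)
    have [measurable]: "partial_max X n \<in> borel_measurable M" using n by measurable
    let ?A = "\<lambda>i. {\<omega> \<in> space M. u * x n < X i \<omega> \<and> R n i \<omega> \<in> {r. \<eta> * x n < \<bar>r\<bar>}}"
    let ?B = "\<lambda>i. {\<omega> \<in> space M. u * T n \<omega> < X i \<omega> \<and> x n \<le> T n \<omega> \<and> \<bar>R n i \<omega>\<bar> \<le> \<eta> * x n}"
    have meas: "?A i \<in> events" "?B i \<in> events" if "i \<in> {1..n}" for i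
    proof -
      have [measurable]: "X i \<in> borel_measurable M" using that by auto
      show "?A i \<in> events" "?B i \<in> events" unfolding mem_Collect_eq by measurable
    qed
    have "jump_prob n u \<le> prob (\<Union>i\<in>{1..n}. ?A i \<union> ?B i)"
      unfolding jump_prob_def
    proof (rule finite_measure_mono)
      show "{\<omega> \<in> space M. u * T n \<omega> < partial_max X n \<omega> \<and> x n \<le> T n \<omega>} \<subseteq> (\<Union>i\<in>{1..n}. ?A i \<union> ?B i)"
      proof
        fix \<omega> assume \<omega>: "\<omega> \<in> {\<omega> \<in> space M. u * T n \<omega> < partial_max X n \<omega> \<and> x n \<le> T n \<omega>}"
        then have "\<exists>i\<in>{1..n}. u * T n \<omega> < X i \<omega>"
          unfolding partial_max_def using n by (auto simp: Max_gr_iff)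
        then obtain i where i: "i \<in> {1..n}" "u * T n \<omega> < X i \<omega>" by auto
        have "u * x n \<le> u * T n \<omega>" using \<omega> assms by (intro mult_left_mono) auto
        then have "\<omega> \<in> ?A i \<union> ?B i" using i \<omega> by auto
        then show "\<omega> \<in> (\<Union>i\<in>{1..n}. ?A i \<union> ?B i)" using i(1) by auto
      qed
    qed (use meas in auto)
    also have "\<dots> \<le> (\<Sum>i=1..n. prob (?A i \<union> ?B i))"
      using meas by (intro measure_UNION_le) auto
    also have "\<dots> \<le> (\<Sum>i=1..n. \<epsilon> * t (x n) + prob (?B i))"
    proof (rule sum_mono)
      fix i assume i: "i \<in> {1..n}"
      have "prob (?A i) = t (u * x n) * prob {\<omega> \<in> space M. R n i \<omega> \<in> {r. \<eta> * x n < \<bar>r\<bar>}}"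
        by (rule prob_jump_indep[OF i]) measurable
      also have "\<dots> \<le> (K * t (x n)) * (\<epsilon> / K)"
        using elim i tail_nonneg K(1) by (intro mult_mono) auto
      also have "\<dots> = \<epsilon> * t (x n)" using K(1) by simp
      finally have "prob (?A i) \<le> \<epsilon> * t (x n)" .
      moreover have "prob (?A i \<union> ?B i) \<le> prob (?A i) + prob (?B i)"
        using meas[OF i] by (rule measure_Un_le)
      ultimately show "prob (?A i \<union> ?B i) \<le> \<epsilon> * t (x n) + prob (?B i)" by linarith
    qed
    also have "\<dots> = \<epsilon> * (real n * t (x n)) + (\<Sum>i=1..n. prob (?B i))"
      by (simp add: sum.distrib)
    finally show ?case .
  qed
qed

text \<open>A remainder of size at most \<open>\<eta> * x n\<close> forces
  \<open>X i \<ge> (1 - \<eta>) * x n > x n / l\<close>. Summing the tails at \<open>x n / l\<close>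
  and using intermediate regular variation there costs only a factor close to 1.\<close>

lemma jump_prob_upper:
  assumes "0 < u" "0 < \<epsilon>"
  shows "\<forall>\<^sub>F n in sequentially. jump_prob n u \<le> (1 + \<epsilon>) * (real n * t (x n))"
proof -
  \<comment> \<open>This choice gives \<open>1 / (1 - e) = 1 + \<epsilon> / 2\<close>; the other
    \<open>\<epsilon> / 2\<close> pays for large remainders.\<close>
  define e where "e = \<epsilon> / (2 + \<epsilon>)"
  have e: "0 < e" "1 - e = 2 / (2 + \<epsilon>)" using assms by (auto simp: e_def field_simps)
  obtain l0 where l0: "1 < l0"
    "\<And>l. 1 < l \<Longrightarrow> l < l0 \<Longrightarrow> \<forall>\<^sub>F y in at_top. (1 - e) * t y \<le> t (l * y)"
    using intermediate_regularly_varyingD[OF irv e(1)] by blast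
  obtain l where l: "1 < l" "l < l0" using l0(1) dense by blast
  \<comment> \<open>Half of the available gap, so that \<open>1 - \<eta>\<close> is the midpoint of
    \<open>1 / l\<close> and 1.\<close>
  define \<eta> where "\<eta> = (1 - 1 / l) / 2"
  have \<eta>: "0 < \<eta>" "1 / l < 1 - \<eta>" using l by (auto simp: \<eta>_def field_simps)
  have "filterlim (\<lambda>n. 1 / l * x n) at_top sequentially"
    using l by (intro filterlim_tendsto_pos_mult_at_top[OF tendsto_const] x_lim) auto
  then have "\<forall>\<^sub>F n in sequentially. (1 - e) * t (1 / l * x n) \<le> t (l * (1 / l * x n))"
    using l0(2)[OF l] unfolding filterlim_iff by blast
  moreover have "\<forall>\<^sub>F n in sequentially. 1 \<le> x n" using x_lim by (simp add: filterlim_at_top)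
  moreover have "\<forall>\<^sub>F n in sequentially. jump_prob n u \<le> \<epsilon> / 2 * (real n * t (x n)) +
    (\<Sum>i=1..n. prob {\<omega> \<in> space M. u * T n \<omega> < X i \<omega> \<and> x n \<le> T n \<omega> \<and> \<bar>R n i \<omega>\<bar> \<le> \<eta> * x n})"
    using assms \<eta> by (intro jump_prob_le) auto
  ultimately show ?thesis
  proof eventually_elim
    case (elim n)
    have t: "t (1 / l * x n) \<le> (1 + \<epsilon> / 2) * t (x n)"
      using elim(1) l assms unfolding e(2) by (simp add: field_simps)
    have "(\<Sum>i=1..n. prob {\<omega> \<in> space M. u * T n \<omega> < X i \<omega> \<and> x n \<le> T n \<omega> \<and> \<bar>R n i \<omega>\<bar> \<le> \<eta> * x n})
      \<le> (\<Sum>i=1..n. (1 + \<epsilon> / 2) * t (x n))"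
    proof (rule sum_mono)
      fix i assume i: "i \<in> {1..n}"
      have "prob {\<omega> \<in> space M. u * T n \<omega> < X i \<omega> \<and> x n \<le> T n \<omega> \<and> \<bar>R n i \<omega>\<bar> \<le> \<eta> * x n}
        \<le> prob {\<omega> \<in> space M. 1 / l * x n < X i \<omega>}"
      proof (rule finite_measure_mono)
        have "1 / l * x n < (1 - \<eta>) * x n" using \<eta> elim by (intro mult_strict_right_mono) auto
        then show "{\<omega> \<in> space M. u * T n \<omega> < X i \<omega> \<and> x n \<le> T n \<omega> \<and> \<bar>R n i \<omega>\<bar> \<le> \<eta> * x n}
          \<subseteq> {\<omega> \<in> space M. 1 / l * x n < X i \<omega>}"
          using T_eq[OF i] by (auto simp: algebra_simps abs_le_iff)
      qed (use i in auto)
      also have "\<dots> = t (1 / l * x n)" using tail_eq[of i] i by simp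
      finally show "prob {\<omega> \<in> space M. u * T n \<omega> < X i \<omega> \<and> x n \<le> T n \<omega> \<and> \<bar>R n i \<omega>\<bar> \<le> \<eta> * x n}
        \<le> (1 + \<epsilon> / 2) * t (x n)" using t by linarith
    qed
    with elim(3) show ?case by (simp add: algebra_simps)
  qed
qed

text \<open>With tolerance \<open>u - 1\<close> no jump with a small remainder survives:
  \<open>X i = T n - R n i > u * T n\<close> would give
  \<open>(u - 1) * T n < (u - 1) * x n\<close>, against \<open>T n \<ge> x n\<close>. Only the error
  term for large remainders is left.\<close>

lemma jump_prob_upper_gt_1:
  assumes "1 < u" "0 < \<epsilon>"
  shows "\<forall>\<^sub>F n in sequentially. jump_prob n u \<le> \<epsilon> * (real n * t (x n))"
proof -
  have "\<forall>\<^sub>F n in sequentially. jump_prob n u \<le> \<epsilon> * (real n * t (x n)) +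
    (\<Sum>i=1..n. prob {\<omega> \<in> space M. u * T n \<omega> < X i \<omega> \<and> x n \<le> T n \<omega> \<and> \<bar>R n i \<omega>\<bar> \<le> (u - 1) * x n})"
    using assms by (intro jump_prob_le) auto
  moreover have "\<forall>\<^sub>F n in sequentially. 1 \<le> x n" using x_lim by (simp add: filterlim_at_top)
  ultimately show ?thesis
  proof eventually_elim
    case (elim n)
    have "{\<omega> \<in> space M. u * T n \<omega> < X i \<omega> \<and> x n \<le> T n \<omega> \<and> \<bar>R n i \<omega>\<bar> \<le> (u - 1) * x n} = {}"
      if i: "i \<in> {1..n}" for i
    proof -
      have False if a: "u * T n \<omega> < X i \<omega>" "x n \<le> T n \<omega>" "\<bar>R n i \<omega>\<bar> \<le> (u - 1) * x n" for \<omega>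
      proof -
        have "X i \<omega> = T n \<omega> - R n i \<omega>" using T_eq[OF i, of \<omega>] by simp
        then have "(u - 1) * T n \<omega> < (u - 1) * x n" using a by (auto simp: algebra_simps)
        then show False using a(2) assms(1) by simp
      qed
      then show ?thesis by blast
    qed
    then have "(\<Sum>i=1..n. prob {\<omega> \<in> space M. u * T n \<omega> < X i \<omega> \<and> x n \<le> T n \<omega> \<and> \<bar>R n i \<omega>\<bar> \<le> (u - 1) * x n}) = 0"
      by (intro sum.neutral) (auto simp del: Collect_empty_eq)
    with elim(1) show ?case by linarith
  qed
qed

text \<open>One summand above \<open>l * x n\<close> with a small remainder already produces the
  event, and by independence this has probability close to \<open>t (x n)\<close> for each index.
  Two summands above \<open>x n\<close> cost only \<open>t (x n) * t (x n)\<close> per pair, so the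
  events for different indices are almost disjoint and their probabilities add up.\<close>

lemma jump_prob_lower:
  assumes u: "0 < u" "u < 1" and "0 < \<epsilon>"
  shows "\<forall>\<^sub>F n in sequentially. (1 - \<epsilon>) * (real n * t (x n)) \<le> jump_prob n u"
proof -
  \<comment> \<open>Three losses of size \<open>\<delta>\<close> occur: the dilation by
    \<open>l\<close>, a large remainder, and double jumps. The minimum with 1 keeps
    \<open>1 - \<delta>\<close> positive.\<close>
  define \<delta> where "\<delta> = min \<epsilon> 1 / 3"
  have \<delta>: "0 < \<delta>" "\<delta> < 1" "3 * \<delta> \<le> \<epsilon>" using assms by (auto simp: \<delta>_def)
  obtain l0 where l0: "1 < l0"
    "\<And>l. 1 < l \<Longrightarrow> l < l0 \<Longrightarrow> \<forall>\<^sub>F y in at_top. (1 - \<delta>) * t y \<le> t (l * y)"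
    using intermediate_regularly_varyingD[OF irv \<delta>(1)] by blast
  obtain l where l: "1 < l" "l < l0" using l0(1) dense by blast
  \<comment> \<open>The bound \<open>l - 1\<close> ensures
    \<open>T n \<ge> l * x n - \<eta> * x n \<ge> x n\<close>. The bound \<open>1 - u\<close>
    ensures \<open>u * R n i \<le> (1 - u) * x n < (1 - u) * X i\<close>, that is,
    \<open>u * T n < X i\<close>.\<close>
  define \<eta> where "\<eta> = min (l - 1) (1 - u)"
  have \<eta>: "0 < \<eta>" "\<eta> \<le> l - 1" "\<eta> \<le> 1 - u" using l u by (auto simp: \<eta>_def)
  have "\<forall>\<^sub>F n in sequentially. (1 - \<delta>) * t (x n) \<le> t (l * x n)"
    using l0(2)[OF l] x_lim by (auto simp: filterlim_iff)
  moreover have "\<forall>\<^sub>F n in sequentially. \<forall>i\<in>{1..n}. prob {\<omega> \<in> space M. \<eta> * x n < \<bar>R n i \<omega>\<bar>} \<le> \<delta>"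
    using \<delta> \<eta> by (intro rest_small) auto
  moreover have "\<forall>\<^sub>F n in sequentially. 1 \<le> x n" using x_lim by (simp add: filterlim_at_top)
  moreover have "\<forall>\<^sub>F n in sequentially. real n * t (x n) < \<delta>"
    using order_tendstoD(2)[OF tail_small \<delta>(1)] .
  ultimately show ?thesis using eventually_ge_at_top[of 1]
  proof eventually_elim
    case (elim n)
    have [measurable]: "partial_max X n \<in> borel_measurable M" using elim(5) by measurable
    have x: "0 < x n" using elim by simp
    define E where "E i = {\<omega> \<in> space M. l * x n < X i \<omega> \<and> R n i \<omega> \<in> {r. \<bar>r\<bar> \<le> \<eta> * x n}}" for i
    define G where "G i j = {\<omega> \<in> space M. x n < X i \<omega> \<and> x n < X j \<omega>}" for i j
    have meas: "E i \<in> events" if "i \<in> {1..n}" for i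
    proof -
      have [measurable]: "X i \<in> borel_measurable M" using that by auto
      show ?thesis unfolding E_def mem_Collect_eq by measurable
    qed
    have measG: "G i j \<in> events" if "i \<in> {1..n}" "j \<in> {1..n}" for i j
    proof -
      have [measurable]: "X i \<in> borel_measurable M" "X j \<in> borel_measurable M" using that by auto
      show ?thesis unfolding G_def by measurable
    qed
    \<comment> \<open>Removing the negligible double jumps makes the events \<open>E i\<close> disjoint.\<close>
    define H where "H i = E i - (\<Union>j\<in>{1..n} - {i}. G i j)" for i
    have measH: "H i \<in> events" if "i \<in> {1..n}" for i
      unfolding H_def using that meas measG by auto
    have lx: "x n < l * x n" using l x by simp
    have "(\<Sum>i=1..n. prob (H i)) = prob (\<Union>i\<in>{1..n}. H i)"
    proof (rule finite_measure_finite_Union[symmetric])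
      show "disjoint_family_on H {1..n}"
      proof (unfold disjoint_family_on_def, intro ballI impI equals0I)
        fix i j \<omega> assume ij: "i \<in> {1..n}" "j \<in> {1..n}" "i \<noteq> j" and \<omega>: "\<omega> \<in> H i \<inter> H j"
        have "x n < X i \<omega>" "x n < X j \<omega>" "\<omega> \<in> space M" using \<omega> lx by (auto simp: H_def E_def)
        then have "\<omega> \<in> G i j" by (simp add: G_def)
        then show False using \<omega> ij by (auto simp: H_def)
      qed
    qed (use measH in auto)
    also have "\<dots> \<le> jump_prob n u"
      unfolding jump_prob_def
    proof (rule finite_measure_mono)
      have "u * T n \<omega> < partial_max X n \<omega> \<and> x n \<le> T n \<omega>" if i: "i \<in> {1..n}" and \<omega>: "\<omega> \<in> E i" for i \<omega>
      proof -
        have X: "l * x n < X i \<omega>" and r: "\<bar>R n i \<omega>\<bar> \<le> \<eta> * x n" using \<omega> by (auto simp: E_def)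
        have "\<eta> * x n \<le> (l - 1) * x n" "\<eta> * x n \<le> (1 - u) * x n"
          using \<eta> x by (auto intro!: mult_right_mono)
        note \<eta>x = this
        have T: "T n \<omega> = X i \<omega> + R n i \<omega>" by (rule T_eq[OF i])
        have "x n \<le> T n \<omega>" unfolding T using X r \<eta>x by (auto simp: algebra_simps abs_le_iff)
        moreover have "u * R n i \<omega> \<le> 1 * \<bar>R n i \<omega>\<bar>"
        proof -
          have "u * R n i \<omega> \<le> u * \<bar>R n i \<omega>\<bar>" using u by (intro mult_left_mono) auto
          also have "\<dots> \<le> 1 * \<bar>R n i \<omega>\<bar>" using u by (intro mult_right_mono) auto
          finally show ?thesis .
        qed
        moreover have "(1 - u) * x n < (1 - u) * X i \<omega>" using u lx X by (intro mult_strict_left_mono) auto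
        moreover have "X i \<omega> \<le> partial_max X n \<omega>" unfolding partial_max_def using i by (intro Max_ge) auto
        ultimately show ?thesis using \<eta>x r unfolding T by (auto simp: algebra_simps)
      qed
      then show "(\<Union>i\<in>{1..n}. H i) \<subseteq> {\<omega> \<in> space M. u * T n \<omega> < partial_max X n \<omega> \<and> x n \<le> T n \<omega>}"
        unfolding H_def by (auto simp: E_def)
    qed measurable
    finally have sumH: "(\<Sum>i=1..n. prob (H i)) \<le> jump_prob n u" .
    have "real n * ((1 - \<epsilon>) * t (x n)) \<le> (\<Sum>i=1..n. prob (H i))"
    proof -
      have "(1 - \<epsilon>) * t (x n) \<le> prob (H i)" if i: "i \<in> {1..n}" for i
      proof -
        have "prob {\<omega> \<in> space M. R n i \<omega> \<in> {r. \<bar>r\<bar> \<le> \<eta> * x n}} =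
            prob (space M - {\<omega> \<in> space M. \<eta> * x n < \<bar>R n i \<omega>\<bar>})"
          by (intro arg_cong[where f = prob]) auto
        also have "\<dots> = 1 - prob {\<omega> \<in> space M. \<eta> * x n < \<bar>R n i \<omega>\<bar>}"
          by (rule prob_compl) measurable
        finally have "1 - \<delta> \<le> prob {\<omega> \<in> space M. R n i \<omega> \<in> {r. \<bar>r\<bar> \<le> \<eta> * x n}}"
          using elim(2) i by auto
        then have "(1 - \<delta>) * t (x n) * (1 - \<delta>) \<le> t (l * x n) * prob {\<omega> \<in> space M. R n i \<omega> \<in> {r. \<bar>r\<bar> \<le> \<eta> * x n}}"
          using elim(1) \<delta> tail_nonneg by (intro mult_mono) auto
        also have "\<dots> = prob (E i)"
          unfolding E_def by (rule prob_jump_indep[OF i, symmetric]) measurable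
        finally have E: "(1 - \<delta>) * t (x n) * (1 - \<delta>) \<le> prob (E i)" .
        \<comment> \<open>At most \<open>n\<close> partners \<open>j\<close> contribute
          \<open>t (x n) * t (x n)\<close> each, and \<open>n * t (x n)\<close> is below
          \<open>\<delta>\<close>.\<close>
        have "prob (\<Union>j\<in>{1..n} - {i}. G i j) \<le> (\<Sum>j\<in>{1..n} - {i}. prob (G i j))"
          using measG i by (intro measure_UNION_le) auto
        also have "\<dots> = (\<Sum>j\<in>{1..n} - {i}. t (x n) * t (x n))"
          unfolding G_def using i by (intro sum.cong refl prob_two_jumps) auto
        also have "\<dots> \<le> real n * (t (x n) * t (x n))"
          using i by (auto intro!: mult_right_mono)
        also have "\<dots> \<le> \<delta> * t (x n)"
          using elim(4) tail_nonneg[of "x n"] by (auto simp: mult.assoc[symmetric] intro!: mult_right_mono)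
        finally have G: "prob (\<Union>j\<in>{1..n} - {i}. G i j) \<le> \<delta> * t (x n)" .
        have "prob (E i) \<le> prob (H i \<union> (\<Union>j\<in>{1..n} - {i}. G i j))"
          using measH[OF i] measG i
          by (intro finite_measure_mono sets.Un sets.finite_UN) (auto simp: H_def)
        also have "\<dots> \<le> prob (H i) + prob (\<Union>j\<in>{1..n} - {i}. G i j)"
          using measH[OF i] measG i by (intro measure_Un_le) auto
        also note G
        finally have "prob (E i) \<le> prob (H i) + \<delta> * t (x n)" by simp
        with E have "(1 - \<delta>) * t (x n) * (1 - \<delta>) \<le> prob (H i) + \<delta> * t (x n)" by (rule order_trans)
        moreover have "(1 - 3 * \<delta>) * t (x n) + \<delta> * \<delta> * t (x n) = (1 - \<delta>) * t (x n) * (1 - \<delta>) - \<delta> * t (x n)"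
          by (simp add: algebra_simps)
        moreover have "(1 - \<epsilon>) * t (x n) \<le> (1 - 3 * \<delta>) * t (x n)"
          using \<delta> tail_nonneg by (intro mult_right_mono) auto
        moreover have "0 \<le> \<delta> * \<delta> * t (x n)" using tail_nonneg by simp
        ultimately show ?thesis by (smt (verit))
      qed
      then have "(\<Sum>i=1..n. (1 - \<epsilon>) * t (x n)) \<le> (\<Sum>i=1..n. prob (H i))" by (intro sum_mono) auto
      then show ?thesis by simp
    qed
    with sumH show ?case by (metis mult.left_commute order_trans)
  qed
qed

end

section \<open>The conditional distribution function and its weak limit\<close>

lemma cdf_two_point_mixture:
  assumes "0 \<le> s" "s \<le> 1"
  shows "cdf (two_point_mixture s y z) u = (1 - s) * indicator {..u} y + s * indicator {..u} z"
proof -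
  have "emeasure (two_point_mixture s y z) {..u} = ennreal ((1 - s) * indicator {..u} y + s * indicator {..u} z)"
    using assms by (subst emeasure_two_point_mixture) (auto simp: indicator_def ennreal_plus[symmetric] simp del: ennreal_plus)
  then show ?thesis using assms by (simp add: cdf_def measure_def del: ennreal_plus)
qed

context one_big_jump
begin

definition exceed_prob :: "nat \<Rightarrow> real" where
  "exceed_prob n = prob {\<omega> \<in> space M. x n \<le> T n \<omega>}"

lemma eventually_x_ge: "\<forall>\<^sub>F n in sequentially. c \<le> x n"
  using x_lim by (simp add: filterlim_at_top)

lemma jump_prob_le_exceed_prob: "jump_prob n u \<le> exceed_prob n"
  unfolding jump_prob_def exceed_prob_def by (rule finite_measure_mono) auto

lemma jump_prob_antimono:
  assumes "1 \<le> n" "0 \<le> x n" "u \<le> v"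
  shows "jump_prob n v \<le> jump_prob n u"
  unfolding jump_prob_def
proof (rule finite_measure_mono)
  have "u * T n \<omega> \<le> v * T n \<omega>" if "x n \<le> T n \<omega>" for \<omega>
    using assms that by (intro mult_right_mono) auto
  then show "{\<omega> \<in> space M. v * T n \<omega> < partial_max X n \<omega> \<and> x n \<le> T n \<omega>}
    \<subseteq> {\<omega> \<in> space M. u * T n \<omega> < partial_max X n \<omega> \<and> x n \<le> T n \<omega>}" by force
  have [measurable]: "partial_max X n \<in> borel_measurable M" using assms by measurable
  show "{\<omega> \<in> space M. u * T n \<omega> < partial_max X n \<omega> \<and> x n \<le> T n \<omega>} \<in> events" by measurable
qed

lemma eventually_expected_jumps_pos: "\<forall>\<^sub>F n in sequentially. 0 < real n * t (x n)"
proof -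
  have "\<forall>\<^sub>F y in at_top. 0 < t y" using irv by (simp add: intermediate_regularly_varying_def)
  then have "\<forall>\<^sub>F n in sequentially. 0 < t (x n)" using x_lim unfolding filterlim_iff by blast
  with eventually_ge_at_top[of 1] show ?thesis by eventually_elim auto
qed

text \<open>Positivity of the conditioning event comes from the lower jump bound at the sample value
  \<open>u = 1 / 2\<close>, since the tail is eventually positive.\<close>

lemma eventually_exceed_prob_pos: "\<forall>\<^sub>F n in sequentially. 0 < exceed_prob n"
proof -
  have "\<forall>\<^sub>F n in sequentially. (1 - 1 / 2) * (real n * t (x n)) \<le> jump_prob n (1 / 2)"
    by (rule jump_prob_lower) auto
  then show ?thesis using eventually_expected_jumps_pos
  proof eventually_elim
    case (elim n)
    have "0 < (1 - 1 / 2) * (real n * t (x n))" using elim(2) by simp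
    also note elim(1)
    also note jump_prob_le_exceed_prob
    finally show ?case .
  qed
qed

lemma jump_prob_sim:
  assumes "0 < u" "u < 1"
  shows "(\<lambda>n. jump_prob n u / (real n * t (x n))) \<longlonglongrightarrow> 1"
proof (rule order_tendstoI)
  fix c :: real assume "c < 1"
  then have "\<forall>\<^sub>F n in sequentially. (1 - (1 - c) / 2) * (real n * t (x n)) \<le> jump_prob n u"
    using assms by (intro jump_prob_lower) auto
  then show "\<forall>\<^sub>F n in sequentially. c < jump_prob n u / (real n * t (x n))"
    using eventually_expected_jumps_pos
  proof eventually_elim
    case (elim n)
    have "c < 1 - (1 - c) / 2" using \<open>c < 1\<close> by (simp add: field_simps)
    also have "\<dots> \<le> jump_prob n u / (real n * t (x n))" using elim by (subst le_divide_eq) simp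
    finally show ?case .
  qed
next
  fix c :: real assume "1 < c"
  then have "\<forall>\<^sub>F n in sequentially. jump_prob n u \<le> (1 + (c - 1) / 2) * (real n * t (x n))"
    using assms by (intro jump_prob_upper) auto
  then show "\<forall>\<^sub>F n in sequentially. jump_prob n u / (real n * t (x n)) < c"
    using eventually_expected_jumps_pos
  proof eventually_elim
    case (elim n)
    then have "jump_prob n u / (real n * t (x n)) \<le> 1 + (c - 1) / 2" by (subst divide_le_eq) simp
    also have "\<dots> < c" using \<open>1 < c\<close> by (simp add: field_simps)
    finally show ?case .
  qed
qed

lemma jump_prob_negligible:
  assumes "1 < u"
  shows "(\<lambda>n. jump_prob n u / (real n * t (x n))) \<longlonglongrightarrow> 0"
proof (rule order_tendstoI)
  fix c :: real assume "c < 0"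
  moreover have "0 \<le> jump_prob n u / (real n * t (x n))" for n
    using tail_nonneg by (auto simp: jump_prob_def)
  ultimately show "\<forall>\<^sub>F n in sequentially. c < jump_prob n u / (real n * t (x n))"
    by (auto intro!: always_eventually elim: less_le_trans)
next
  fix c :: real assume "0 < c"
  then have "\<forall>\<^sub>F n in sequentially. jump_prob n u \<le> c / 2 * (real n * t (x n))"
    using assms by (intro jump_prob_upper_gt_1) auto
  then show "\<forall>\<^sub>F n in sequentially. jump_prob n u / (real n * t (x n)) < c"
    using eventually_expected_jumps_pos
  proof eventually_elim
    case (elim n)
    then have "jump_prob n u / (real n * t (x n)) \<le> c / 2" by (subst divide_le_eq) simp
    also have "\<dots> < c" using \<open>0 < c\<close> by simp
    finally show ?case .
  qed
qed

text \<open>If the maximum were at most \<open>u * T n\<close>, summing over all indices would give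
  \<open>T n \<le> n * (u * T n - mean M \<xi>)\<close>. As \<open>T n > 0\<close>, the bracket is
  positive, and \<open>u < 0\<close> then bounds \<open>T n\<close> by a constant, which fails once
  \<open>x n\<close> is large.\<close>

lemma jump_prob_neg:
  assumes u: "u < 0"
  shows "\<forall>\<^sub>F n in sequentially. jump_prob n u = exceed_prob n"
  using eventually_x_ge[of 1] eventually_x_ge[of "\<bar>mean M \<xi>\<bar> / (- u) + 1"] eventually_ge_at_top[of 1]
proof eventually_elim
  case (elim n)
  have "u * T n \<omega> < partial_max X n \<omega>" if le: "x n \<le> T n \<omega>" for \<omega>
  proof (rule ccontr)
    assume "\<not> u * T n \<omega> < partial_max X n \<omega>"
    moreover have "X i \<omega> \<le> partial_max X n \<omega>" if "i \<in> {1..n}" for i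
      unfolding partial_max_def using that by (intro Max_ge) auto
    ultimately have "X i \<omega> \<le> u * T n \<omega>" if "i \<in> {1..n}" for i
      using that by force
    then have "partial_sum X n \<omega> \<le> real n * (u * T n \<omega>)"
      unfolding partial_sum_def using sum_bounded_above[of "{1..n}" "\<lambda>i. X i \<omega>"] by auto
    then have "T n \<omega> \<le> real n * (u * T n \<omega> - mean M \<xi>)" by (simp add: T_def algebra_simps)
    moreover have "0 < T n \<omega>" using le elim(1) by linarith
    ultimately have "0 < real n * (u * T n \<omega> - mean M \<xi>)" by linarith
    then have "0 < u * T n \<omega> - mean M \<xi>" by (simp add: zero_less_mult_iff)
    then have "(- u) * T n \<omega> < \<bar>mean M \<xi>\<bar>" by linarith
    then have "T n \<omega> < \<bar>mean M \<xi>\<bar> / (- u)" using u by (simp add: field_simps)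
    then show False using le elim(2) by linarith
  qed
  then show ?case unfolding jump_prob_def exceed_prob_def by (intro arg_cong[where f = prob]) auto
qed

text \<open>On the conditioning event the denominator is at least \<open>x n > 0\<close>, so the
  ratio being at most \<open>u\<close> is the complement of the jump event inside it.\<close>

lemma cdf_cond_law:
  assumes n: "1 \<le> n" and x: "0 < x n" and p: "0 < exceed_prob n"
  shows "cdf (cond_law M (\<lambda>\<omega>. partial_max X n \<omega> / T n \<omega>) {\<omega> \<in> space M. x n \<le> T n \<omega>}) u
    = 1 - jump_prob n u / exceed_prob n"
proof -
  let ?A = "{\<omega> \<in> space M. x n \<le> T n \<omega>}"
  let ?Y = "\<lambda>\<omega>. partial_max X n \<omega> / T n \<omega>"
  let ?J = "{\<omega> \<in> space M. u * T n \<omega> < partial_max X n \<omega> \<and> x n \<le> T n \<omega>}"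
  have [measurable]: "partial_max X n \<in> borel_measurable M" using n by measurable
  have A: "?A \<in> events" and J: "?J \<in> events" by measurable
  have Y: "?Y -` {..u} \<inter> space M \<in> events" by measurable
  have "cdf (cond_law M ?Y ?A) u = measure (uniform_measure M ?A) (?Y -` {..u} \<inter> space M)"
    unfolding cdf_def cond_law_def by (subst measure_distr) auto
  also have "\<dots> = prob (?A \<inter> (?Y -` {..u} \<inter> space M)) / prob ?A"
    using A Y p by (intro measure_uniform_measure) (auto simp: exceed_prob_def emeasure_eq_measure)
  also have "?A \<inter> (?Y -` {..u} \<inter> space M) = ?A - ?J"
    using x by (auto simp: divide_le_eq not_less)
  also have "prob (?A - ?J) = exceed_prob n - jump_prob n u"
    unfolding exceed_prob_def jump_prob_def using A J by (intro finite_measure_Diff) auto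
  finally show ?thesis using p by (simp add: exceed_prob_def[symmetric] diff_divide_distrib)
qed

text \<open>By \<open>cdf_cond_law\<close> it suffices to find the limit of
  \<open>jump_prob n u / exceed_prob n\<close>. It is 1 below 0, \<open>s\<close> between 0 and 1,
  and 0 above 1, matching one minus the limiting distribution function; the two atoms are treated
  separately.\<close>

lemma weak_conv_cond_law:
  assumes s: "0 \<le> s" "s \<le> 1" and lim: "(\<lambda>n. real n * t (x n) / exceed_prob n) \<longlonglongrightarrow> s"
  shows "weak_conv_m
    (\<lambda>n. cond_law M (\<lambda>\<omega>. partial_max X n \<omega> / T n \<omega>) {\<omega> \<in> space M. x n \<le> T n \<omega>})
    (two_point_mixture s 0 1)"
  unfolding weak_conv_m_def weak_conv_def
proof (intro allI impI)
  fix u assume cont: "isCont (cdf (two_point_mixture s 0 1)) u"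
  let ?F = "cdf (two_point_mixture s 0 1)"
  \<comment> \<open>The quotient is factored through \<open>n * t (x n)\<close>, which is eventually
    nonzero, and the hypothesis supplies the factor \<open>s\<close>.\<close>
  have trans: "(\<lambda>n. jump_prob n v / exceed_prob n) \<longlonglongrightarrow> l * s"
    if "(\<lambda>n. jump_prob n v / (real n * t (x n))) \<longlonglongrightarrow> l" for v l
  proof (rule Lim_transform_eventually[OF tendsto_mult[OF that lim]])
    show "\<forall>\<^sub>F n in sequentially. jump_prob n v / (real n * t (x n)) * (real n * t (x n) / exceed_prob n) = jump_prob n v / exceed_prob n"
      using eventually_expected_jumps_pos by eventually_elim auto
  qed
  have half: "(\<lambda>n. jump_prob n (1 / 2) / exceed_prob n) \<longlonglongrightarrow> s"
    using trans[OF jump_prob_sim[of "1 / 2"]] by simp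
  \<comment> \<open>At the atoms \<open>0\<close> and \<open>1\<close>, continuity forces \<open>s = 1\<close> and \<open>s = 0\<close> respectively.\<close>
  have left: "?F u = l" if "\<And>n. ?F (u - 1 / real (Suc n)) = l" for l
  proof -
    have "(\<lambda>n. u - 1 / real (Suc n)) \<longlonglongrightarrow> u - 0"
      using LIMSEQ_inverse_real_of_nat by (intro tendsto_diff tendsto_const) (simp add: inverse_eq_divide)
    then have "(\<lambda>n. ?F (u - 1 / real (Suc n))) \<longlonglongrightarrow> ?F u"
      by (intro isCont_tendsto_compose[OF cont]) simp
    then show ?thesis unfolding that by (simp add: LIMSEQ_const_iff)
  qed
  consider "u < 0" | "u = 0" | "0 < u" "u < 1" | "u = 1" | "1 < u" by linarith
  then have "(\<lambda>n. jump_prob n u / exceed_prob n) \<longlonglongrightarrow> 1 - ?F u"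
  proof cases
    case 1
    have "\<forall>\<^sub>F n in sequentially. jump_prob n u / exceed_prob n = 1"
      using jump_prob_neg[OF 1] eventually_exceed_prob_pos by eventually_elim auto
    then show ?thesis using 1 s by (simp add: cdf_two_point_mixture tendsto_eventually)
  next
    case 2
    have "?F u = 0" using 2 s by (intro left) (auto simp: cdf_two_point_mixture indicator_def field_simps)
    then have s1: "s = 1" using 2 s by (simp add: cdf_two_point_mixture)
    \<comment> \<open>Monotonicity in \<open>u\<close> squeezes the quotient between its value at
      \<open>1 / 2\<close>, which tends to \<open>s = 1\<close>, and 1.\<close>
    have "(\<lambda>n. jump_prob n u / exceed_prob n) \<longlonglongrightarrow> 1"
    proof (rule tendsto_sandwich[where h = "\<lambda>_. 1"])
      show "(\<lambda>n. jump_prob n (1 / 2) / exceed_prob n) \<longlonglongrightarrow> 1" using half s1 by simp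
      show "\<forall>\<^sub>F n in sequentially. jump_prob n (1 / 2) / exceed_prob n \<le> jump_prob n u / exceed_prob n"
        using eventually_exceed_prob_pos eventually_x_ge[of 0] eventually_ge_at_top[of 1]
        by eventually_elim (auto intro!: divide_right_mono jump_prob_antimono simp: 2)
      show "\<forall>\<^sub>F n in sequentially. jump_prob n u / exceed_prob n \<le> 1"
        using eventually_exceed_prob_pos by eventually_elim (auto intro!: jump_prob_le_exceed_prob)
    qed auto
    then show ?thesis using \<open>?F u = 0\<close> by simp
  next
    case 3
    then show ?thesis using trans[OF jump_prob_sim[OF 3]] s by (simp add: cdf_two_point_mixture)
  next
    case 4
    have "?F u = 1 - s" using 4 s by (intro left) (auto simp: cdf_two_point_mixture indicator_def)
    then have s0: "s = 0" using 4 s by (simp add: cdf_two_point_mixture)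
    \<comment> \<open>Here the value at \<open>1 / 2\<close>, tending to \<open>s = 0\<close>, is
      the upper bound.\<close>
    have "(\<lambda>n. jump_prob n u / exceed_prob n) \<longlonglongrightarrow> 0"
    proof (rule tendsto_sandwich[where f = "\<lambda>_. 0"])
      show "(\<lambda>n. jump_prob n (1 / 2) / exceed_prob n) \<longlonglongrightarrow> 0" using half s0 by simp
      show "\<forall>\<^sub>F n in sequentially. jump_prob n u / exceed_prob n \<le> jump_prob n (1 / 2) / exceed_prob n"
        using eventually_exceed_prob_pos eventually_x_ge[of 0] eventually_ge_at_top[of 1]
        by eventually_elim (auto intro!: divide_right_mono jump_prob_antimono simp: 4)
      show "\<forall>\<^sub>F n in sequentially. 0 \<le> jump_prob n u / exceed_prob n"
        by (auto simp: jump_prob_def exceed_prob_def)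
    qed auto
    then show ?thesis using \<open>?F u = 1 - s\<close> s0 by simp
  next
    case 5
    then show ?thesis using trans[OF jump_prob_negligible[OF 5]] s by (simp add: cdf_two_point_mixture)
  qed
  from tendsto_diff[OF tendsto_const[of 1] this]
  have "(\<lambda>n. 1 - jump_prob n u / exceed_prob n) \<longlonglongrightarrow> ?F u" by simp
  moreover have "\<forall>\<^sub>F n in sequentially. 1 - jump_prob n u / exceed_prob n =
      cdf (cond_law M (\<lambda>\<omega>. partial_max X n \<omega> / T n \<omega>) {\<omega> \<in> space M. x n \<le> T n \<omega>}) u"
    using eventually_exceed_prob_pos eventually_x_ge[of 1] eventually_ge_at_top[of 1]
    by eventually_elim (simp add: cdf_cond_law)
  ultimately show "(\<lambda>n. cdf (cond_law M (\<lambda>\<omega>. partial_max X n \<omega> / T n \<omega>)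
      {\<omega> \<in> space M. x n \<le> T n \<omega>}) u) \<longlonglongrightarrow> ?F u"
    by (rule Lim_transform_eventually)
qed

end

section \<open>From slow variation and the normalising sequence to the jump setting\<close>

lemma doubling_growth_le:
  fixes V :: "real \<Rightarrow> real"
  assumes mono: "mono V" and V0: "\<And>y. 0 \<le> V y"
    and doubling: "\<And>y. z0 \<le> y \<Longrightarrow> V (2 * y) \<le> 3 / 2 * V y"
    and y: "0 < y" "z0 \<le> y" and z: "y \<le> z"
  shows "V z \<le> 2 * (z / y) * V y"
proof -
  \<comment> \<open>Induction on the number of doublings from \<open>y\<close> to \<open>z\<close>.
    Each full doubling multiplies \<open>V\<close> by at most \<open>3 / 2 < 2\<close>, hence no
    more than linear growth allows; the leading 2 covers the last incomplete doubling, where only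
    monotonicity is available.\<close>
  have "V z \<le> 2 * (z / y) * V y" if "y \<le> z" "z \<le> 2 ^ k * y" for k :: nat and z
    using that
  proof (induction k arbitrary: z)
    case 0
    then have "z = y" by simp
    then show ?case using y V0[of y] by simp
  next
    case (Suc k)
    show ?case
    proof (cases "z \<le> 2 * y")
      case True
      have "V z \<le> V (2 * y)" by (rule monoD[OF mono True])
      also have "\<dots> \<le> 3 / 2 * V y" using y by (intro doubling)
      also have "\<dots> \<le> 2 * (z / y) * V y"
        using Suc.prems y V0 by (intro mult_right_mono) (auto simp: field_simps)
      finally show ?thesis .
    next
      case False
      have "V z \<le> 3 / 2 * V (z / 2)" using doubling[of "z / 2"] False y by simp
      also have "\<dots> \<le> 2 * (2 * ((z / 2) / y) * V y)"
        using Suc.IH[of "z / 2"] Suc.prems False V0[of "z / 2"] by (intro mult_mono) auto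
      finally show ?thesis by simp
    qed
  qed
  moreover obtain k where "z / y < 2 ^ k" using real_arch_pow[of 2] by auto
  then have "z \<le> 2 ^ k * y" using y by (simp add: field_simps)
  ultimately show ?thesis using z by blast
qed

text \<open>Both the tail condition and the weak law reduce to
  \<open>n * V (x n) / (x n)\<^sup>2\<close> tending to 0, where \<open>V\<close> is the truncated
  variance.\<close>

lemma (in prob_space) one_big_jumpI:
  fixes \<xi> :: "'a \<Rightarrow> real" and X :: "nat \<Rightarrow> 'a \<Rightarrow> real" and a x :: "nat \<Rightarrow> real"
  assumes \<xi>_meas [measurable]: "\<xi> \<in> borel_measurable M"
    and iid: "iid_copies M \<xi> X"
    and int: "integrable M \<xi>"
    and sv: "slowly_varying (trunc_var M \<xi>)"
    and a_lim: "filterlim a at_top sequentially"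
    and a_equiv: "(\<lambda>n. trunc_var M \<xi> (a n) / (a n)\<^sup>2) \<sim>[sequentially] (\<lambda>n. 1 / real n)"
    and irv: "intermediate_regularly_varying (tail M \<xi>)"
    and x_a: "filterlim (\<lambda>n. x n / a n) at_top sequentially"
  shows "one_big_jump M \<xi> X x"
proof -
  define V where "V = trunc_var M \<xi>"
  define Y where "Y \<omega> = \<xi> \<omega> - mean M \<xi>" for \<omega>
  have intY: "integrable M Y" unfolding Y_def[abs_def] using int by auto
  then have [measurable]: "Y \<in> borel_measurable M" by auto
  have V_eq: "V z = expectation (\<lambda>\<omega>. (Y \<omega>)\<^sup>2 * indicator {\<omega>. \<bar>Y \<omega>\<bar> \<le> z} \<omega>)" for z
    by (simp add: V_def trunc_var_def Y_def)
  have V0: "0 \<le> V z" for z unfolding V_eq by (intro integral_nonneg_AE AE_I2) auto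
  have intV: "integrable M (\<lambda>\<omega>. (Y \<omega>)\<^sup>2 * indicator {\<omega>. \<bar>Y \<omega>\<bar> \<le> z} \<omega>)" for z
  proof (rule integrable_const_bound[where B = "z\<^sup>2"])
    show "AE \<omega> in M. norm ((Y \<omega>)\<^sup>2 * indicator {\<omega>. \<bar>Y \<omega>\<bar> \<le> z} \<omega>) \<le> z\<^sup>2"
      by (intro AE_I2) (auto simp: indicator_def abs_le_square_iff[symmetric])
  qed measurable
  have V_mono: "mono V"
  proof (rule monoI)
    fix y z :: real assume "y \<le> z"
    then show "V y \<le> V z"
      unfolding V_eq by (intro integral_mono intV) (auto simp: indicator_def)
  qed
  \<comment> \<open>Slow variation with dilation 2 brings the ratio \<open>V (2 * y) / V y\<close>
    below \<open>3 / 2\<close> from some point on.\<close>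
  obtain z0 where z0: "\<And>y. z0 \<le> y \<Longrightarrow> V (2 * y) \<le> 3 / 2 * V y"
  proof -
    have "((\<lambda>y. V (2 * y) / V y) \<longlongrightarrow> 1) at_top"
      using sv unfolding slowly_varying_def V_def by (meson zero_less_numeral)
    then have "\<forall>\<^sub>F y in at_top. V (2 * y) / V y < 3 / 2" by (rule order_tendstoD) simp
    moreover obtain y0 where "\<And>y. y0 \<le> y \<Longrightarrow> 0 < V y"
      using sv unfolding slowly_varying_def V_def by blast
    then have "\<forall>\<^sub>F y in at_top. 0 < V y" by (auto simp: eventually_at_top_linorder)
    ultimately have "\<forall>\<^sub>F y in at_top. V (2 * y) \<le> 3 / 2 * V y"
      by eventually_elim (simp add: divide_less_eq)
    then show ?thesis using that by (auto simp: eventually_at_top_linorder)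
  qed
  have abs_le: "expectation (\<lambda>\<omega>. \<bar>Y \<omega>\<bar> * indicator {\<omega>. z < \<bar>Y \<omega>\<bar>} \<omega>) \<le> 6 * V z / z"
    if "0 < z" "z0 \<le> z" for z
    using integral_abs_gt_le[OF intY that] z0 unfolding V_eq by blast
  have x_lim: "filterlim x at_top sequentially"
  proof -
    have "filterlim (\<lambda>n. x n / a n * a n) at_top sequentially"
      by (intro filterlim_at_top_mult_at_top x_a a_lim)
    moreover have "\<forall>\<^sub>F n in sequentially. 0 < a n" using a_lim by (simp add: filterlim_at_top_dense)
    then have "\<forall>\<^sub>F n in sequentially. x n / a n * a n = x n" by eventually_elim auto
    ultimately show ?thesis by (simp cong: filterlim_cong)
  qed
  have x_ge: "\<forall>\<^sub>F n in sequentially. c \<le> x n" for c using x_lim by (simp add: filterlim_at_top)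
  define q where "q n = real n * V (x n) / (x n)\<^sup>2" for n
  have q0: "0 \<le> q n" for n using V0 by (simp add: q_def)
  \<comment> \<open>Growth at most linear gives
    \<open>V (x n) \<le> 2 * (x n / a n) * V (a n)\<close>. Hence \<open>q n\<close> is at most
    \<open>2 * (n * V (a n) / (a n)\<^sup>2) * (a n / x n)\<close>; the bracket tends to 1 by the
    choice of \<open>a n\<close>, and the last factor to 0.\<close>
  have q_lim: "q \<longlonglongrightarrow> 0"
  proof (rule tendsto_sandwich[where f = "\<lambda>_. 0"])
    have "(\<lambda>n. (V (a n) / (a n)\<^sup>2) / (1 / real n)) \<longlonglongrightarrow> 1"
    proof (rule asymp_equivD_strong)
      show "\<forall>\<^sub>F n in sequentially. V (a n) / (a n)\<^sup>2 \<noteq> 0 \<or> 1 / real n \<noteq> 0"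
        using eventually_gt_at_top[of 0] by eventually_elim auto
    qed (use a_equiv in \<open>simp add: V_def\<close>)
    moreover have "(\<lambda>n. inverse (x n / a n)) \<longlonglongrightarrow> 0"
      by (rule tendsto_inverse_0_at_top[OF x_a])
    ultimately have "(\<lambda>n. 2 * ((V (a n) / (a n)\<^sup>2) / (1 / real n)) * inverse (x n / a n)) \<longlonglongrightarrow> 2 * 1 * 0"
      by (intro tendsto_mult tendsto_const)
    then show "(\<lambda>n. 2 * ((V (a n) / (a n)\<^sup>2) / (1 / real n)) * inverse (x n / a n)) \<longlonglongrightarrow> 0" by simp
    have "\<forall>\<^sub>F n in sequentially. max 1 z0 \<le> a n" using a_lim unfolding filterlim_at_top by blast
    moreover have "\<forall>\<^sub>F n in sequentially. 1 \<le> x n / a n" using x_a unfolding filterlim_at_top by blast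
    ultimately show "\<forall>\<^sub>F n in sequentially. q n \<le> 2 * ((V (a n) / (a n)\<^sup>2) / (1 / real n)) * inverse (x n / a n)"
    proof eventually_elim
      case (elim n)
      have a: "0 < a n" "z0 \<le> a n" using elim(1) by auto
      have x: "a n \<le> x n" using elim(2) a by (simp add: le_divide_eq)
      have "V (x n) \<le> 2 * (x n / a n) * V (a n)"
        using doubling_growth_le[OF V_mono V0 z0 a x] .
      then have "q n \<le> real n * (2 * (x n / a n) * V (a n)) / (x n)\<^sup>2"
        unfolding q_def by (intro divide_right_mono mult_left_mono) auto
      also have "\<dots> = 2 * ((V (a n) / (a n)\<^sup>2) / (1 / real n)) * inverse (x n / a n)"
        using a x by (simp add: field_simps power2_eq_square)
      finally show ?case .
    qed
  qed (use q0 in auto)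
  show ?thesis
  proof
    show "iid_copies M \<xi> X" "intermediate_regularly_varying (tail M \<xi>)"
      "filterlim x at_top sequentially" by fact+
    show "(\<lambda>n. real n * tail M \<xi> (x n)) \<longlonglongrightarrow> 0"
    proof (rule tendsto_sandwich[where f = "\<lambda>_. 0"])
      show "(\<lambda>n. 24 * q n) \<longlonglongrightarrow> 0" using tendsto_mult[OF tendsto_const[of 24] q_lim] by simp
      have tail: "tail M \<xi> y = prob {\<omega> \<in> space M. y < \<xi> \<omega>}" for y
        unfolding tail_def by (rule one_minus_cdf_distr) measurable
      then show "\<forall>\<^sub>F n in sequentially. 0 \<le> real n * tail M \<xi> (x n)" by simp
      show "\<forall>\<^sub>F n in sequentially. real n * tail M \<xi> (x n) \<le> 24 * q n"
        using x_ge[of "2 * \<bar>mean M \<xi>\<bar>"] x_ge[of 1] x_ge[of "2 * z0"]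
      proof eventually_elim
        case (elim n)
        \<comment> \<open>Half of \<open>x n\<close> makes room for the centring:
          \<open>\<xi> > 2 * z\<close> and \<open>\<bar>mean M \<xi>\<bar> \<le> z\<close> give
          \<open>\<bar>Y\<bar> > z\<close>. Markov's inequality with the first-moment bound yields
          \<open>6 * V z / z\<^sup>2\<close>, and \<open>z\<^sup>2 = (x n)\<^sup>2 / 4\<close>
          explains the 24.\<close>
        define z where "z = x n / 2"
        have z: "0 < z" "z0 \<le> z" "\<bar>mean M \<xi>\<bar> \<le> z" "x n = 2 * z" using elim by (auto simp: z_def)
        have "tail M \<xi> (x n) \<le> prob {\<omega> \<in> space M. z \<le> \<bar>Y \<omega>\<bar> * indicator {y. z < \<bar>y\<bar>} (Y \<omega>)}"
          unfolding tail using z by (intro finite_measure_mono) (auto simp: Y_def indicator_def)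
        also have "\<dots> \<le> expectation (\<lambda>\<omega>. \<bar>Y \<omega>\<bar> * indicator {y. z < \<bar>y\<bar>} (Y \<omega>)) / z"
        proof (intro integral_Markov_inequality_measure[OF _ sets.top])
          show "integrable M (\<lambda>\<omega>. \<bar>Y \<omega>\<bar> * indicator {y. z < \<bar>y\<bar>} (Y \<omega>))"
            by (rule Bochner_Integration.integrable_bound[OF intY]) (auto simp: indicator_def)
        qed (use z in auto)
        also have "expectation (\<lambda>\<omega>. \<bar>Y \<omega>\<bar> * indicator {y. z < \<bar>y\<bar>} (Y \<omega>)) \<le> 6 * V z / z"
          using abs_le[OF z(1,2)] by (simp add: indicator_def)
        also have "V z \<le> V (x n)" using z by (intro monoD[OF V_mono]) auto
        finally have "tail M \<xi> (x n) \<le> 6 * V (x n) / z / z"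
          using z by (simp add: divide_right_mono)
        then have "real n * tail M \<xi> (x n) \<le> real n * (6 * V (x n) / z / z)" by (intro mult_left_mono) auto
        also have "\<dots> = 24 * q n" by (simp add: q_def z_def power2_eq_square)
        finally show ?case .
      qed
    qed auto
    fix \<eta> \<delta> :: real assume \<eta>: "0 < \<eta>" and \<delta>: "0 < \<delta>"
    \<comment> \<open>This is the bound of \<open>prob_abs_sum_gt_le\<close> with truncation level
      \<open>x n\<close>, deviation \<open>\<eta> * x n\<close>, second-moment bound
      \<open>V (x n)\<close> and \<open>w = 6 * V (x n) / x n\<close>, so that
      \<open>n * w / x n = 6 * q n\<close>.\<close>
    have "(\<lambda>n. 12 * q n / \<eta> + 4 * (q n + (6 * q n)\<^sup>2) / \<eta>\<^sup>2) \<longlonglongrightarrow> 12 * 0 / \<eta> + 4 * (0 + (6 * 0)\<^sup>2) / \<eta>\<^sup>2"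
      using \<eta> by (intro tendsto_intros q_lim) auto
    then have "\<forall>\<^sub>F n in sequentially. 12 * q n / \<eta> + 4 * (q n + (6 * q n)\<^sup>2) / \<eta>\<^sup>2 < \<delta>"
      using \<delta> by (intro order_tendstoD(2)) auto
    then show "\<forall>\<^sub>F n in sequentially. \<forall>J\<subseteq>{1..n}. prob {\<omega> \<in> space M. \<eta> * x n < \<bar>\<Sum>j\<in>J. X j \<omega> - mean M \<xi>\<bar>} \<le> \<delta>"
      using x_ge[of 1] x_ge[of z0]
    proof (eventually_elim, safe)
      fix n J assume le: "12 * q n / \<eta> + 4 * (q n + (6 * q n)\<^sup>2) / \<eta>\<^sup>2 < \<delta>"
        and x: "1 \<le> x n" "z0 \<le> x n" and J: "J \<subseteq> {1..n}"
      have ind: "indep_vars (\<lambda>_. borel) X {1..}" and distr: "\<And>j. 1 \<le> j \<Longrightarrow> distr M borel (X j) = distr M borel \<xi>"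
        using iid by (auto simp: iid_copies_def)
      have cJ: "real (card J) \<le> real n" using card_mono[OF _ J] by simp
      have meas: "X j \<in> borel_measurable M" if "j \<in> J" for j
        using ind J that by (auto simp: indep_vars_def2)
      have transfer: "expectation (\<lambda>\<omega>. g (X j \<omega>)) = expectation (\<lambda>\<omega>. g (\<xi> \<omega>))"
        if "j \<in> J" "g \<in> borel_measurable borel" for g :: "real \<Rightarrow> real" and j
      proof -
        have "expectation (\<lambda>\<omega>. g (X j \<omega>)) = integral\<^sup>L (distr M borel (X j)) g"
          using meas that by (intro integral_distr[symmetric]) auto
        also have "\<dots> = expectation (\<lambda>\<omega>. g (\<xi> \<omega>))"
          using distr[of j] that J by (subst distr) (auto intro!: integral_distr)
        finally show ?thesis .
      qed
      define w where "w = 6 * V (x n) / x n"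
      have "prob {\<omega> \<in> space M. \<eta> * x n < \<bar>\<Sum>j\<in>J. X j \<omega> - mean M \<xi>\<bar>}
        \<le> 2 * (card J * w) / (\<eta> * x n) + 4 * (card J * V (x n) + (card J * w)\<^sup>2) / (\<eta> * x n)\<^sup>2"
      proof (rule prob_abs_sum_gt_le[where z = "x n"])
        show "finite J" using J finite_subset by blast
        show "indep_vars (\<lambda>_. borel) (\<lambda>j \<omega>. X j \<omega> - mean M \<xi>) J"
          using J by (intro indep_vars_compose2[OF indep_vars_subset[OF ind], where Y = "\<lambda>_ y. y - mean M \<xi>"]) auto
        show "integrable M (\<lambda>\<omega>. X j \<omega> - mean M \<xi>)" if "j \<in> J" for j
        proof -
          have "integrable (distr M borel (X j)) (\<lambda>y. y)"
            using distr[of j] that J int by (auto simp: integrable_distr_eq)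
          then show ?thesis using meas[OF that] by (auto simp: integrable_distr_eq)
        qed
        show "expectation (\<lambda>\<omega>. X j \<omega> - mean M \<xi>) = 0" if "j \<in> J" for j
          using transfer[OF that, of "\<lambda>y. y - mean M \<xi>"] int by (simp add: mean_def prob_space)
        show "expectation (\<lambda>\<omega>. (X j \<omega> - mean M \<xi>)\<^sup>2 * indicator {\<omega>. \<bar>X j \<omega> - mean M \<xi>\<bar> \<le> x n} \<omega>) \<le> V (x n)"
          if "j \<in> J" for j
          using transfer[OF that, of "\<lambda>y. (y - mean M \<xi>)\<^sup>2 * indicator {y. \<bar>y - mean M \<xi>\<bar> \<le> x n} y"]
          by (simp add: V_eq Y_def indicator_def)
        show "expectation (\<lambda>\<omega>. \<bar>X j \<omega> - mean M \<xi>\<bar> * indicator {\<omega>. x n < \<bar>X j \<omega> - mean M \<xi>\<bar>} \<omega>) \<le> w"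
          if "j \<in> J" for j
          using transfer[OF that, of "\<lambda>y. \<bar>y - mean M \<xi>\<bar> * indicator {y. x n < \<bar>y - mean M \<xi>\<bar>} y"] abs_le[of "x n"] x
          by (simp add: w_def Y_def indicator_def)
      qed (use \<eta> x in auto)
      \<comment> \<open>Replacing \<open>card J\<close> by \<open>n\<close> makes the bound uniform
        in \<open>J\<close>.\<close>
      also have "\<dots> \<le> 2 * (n * w) / (\<eta> * x n) + 4 * (n * V (x n) + (n * w)\<^sup>2) / (\<eta> * x n)\<^sup>2"
        using cJ V0[of "x n"] x \<eta> by (intro add_mono divide_right_mono mult_left_mono power_mono mult_right_mono) (auto simp: w_def)
      also have "\<dots> = 12 * q n / \<eta> + 4 * (q n + (6 * q n)\<^sup>2) / \<eta>\<^sup>2"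
        using x \<eta> by (simp add: w_def q_def field_simps power2_eq_square)
      finally show "prob {\<omega> \<in> space M. \<eta> * x n < \<bar>\<Sum>j\<in>J. X j \<omega> - mean M \<xi>\<bar>} \<le> \<delta>" using le by linarith
    qed
  qed
qed

section \<open>Passage to the given centring sequence\<close>

theorem corollary2p21:
  fixes M :: "'a measure" and \<xi> :: "'a \<Rightarrow> real" and X :: "nat \<Rightarrow> 'a \<Rightarrow> real"
    and a b x :: "nat \<Rightarrow> real" and s :: real
  assumes "prob_space M"
    and "\<xi> \<in> borel_measurable M"
    and "iid_copies M \<xi> X"
    and "integrable M \<xi>"
    and "slowly_varying (trunc_var M \<xi>)"
    and "\<And>n. n \<ge> 1 \<Longrightarrow> 0 < a n"
    and "filterlim a at_top sequentially"
    and "(\<lambda>n. trunc_var M \<xi> (a n) / (a n)\<^sup>2) \<sim>[sequentially] (\<lambda>n. 1 / real n)"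
    and "\<And>n. n \<ge> 1 \<Longrightarrow> b n = real n * mean M \<xi>"
    and "intermediate_regularly_varying (tail M \<xi>)"
    and "filterlim (\<lambda>n. x n / a n) at_top sequentially"
    and "0 \<le> s" and "s \<le> 1"
    and "(\<lambda>n. real n * tail M \<xi> (x n) /
              measure M {\<omega> \<in> space M. partial_sum X n \<omega> - b n \<ge> x n}) \<longlonglongrightarrow> s"
  shows "weak_conv_m
           (\<lambda>n. cond_law M (\<lambda>\<omega>. partial_max X n \<omega> / (partial_sum X n \<omega> - b n))
                  {\<omega> \<in> space M. partial_sum X n \<omega> - b n \<ge> x n})
           (two_point_mixture s 0 1)"
proof -
  interpret prob_space M by fact
  interpret one_big_jump M \<xi> X x
    using assms by (intro one_big_jumpI) auto
  \<comment> \<open>The value of \<open>b 0\<close> is unconstrained, so the given centring agrees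
    with that of \<open>T\<close> only for \<open>n \<ge> 1\<close>; the limits depend only on
    eventual values.\<close>
  have ev: "\<forall>\<^sub>F n in sequentially. \<forall>\<omega>. partial_sum X n \<omega> - b n = T n \<omega>"
    using eventually_ge_at_top[of 1] by eventually_elim (simp add: T_def assms(9))
  have "(\<lambda>n. real n * t (x n) / exceed_prob n) \<longlonglongrightarrow> s"
  proof (rule Lim_transform_eventually[OF assms(14)])
    show "\<forall>\<^sub>F n in sequentially. real n * t (x n) /
      measure M {\<omega> \<in> space M. partial_sum X n \<omega> - b n \<ge> x n} = real n * t (x n) / exceed_prob n"
      using ev by eventually_elim (simp add: exceed_prob_def)
  qed
  then have conv: "weak_conv_m
    (\<lambda>n. cond_law M (\<lambda>\<omega>. partial_max X n \<omega> / T n \<omega>) {\<omega> \<in> space M. x n \<le> T n \<omega>})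
    (two_point_mixture s 0 1)"
    by (rule weak_conv_cond_law[OF assms(12,13)])
  have "\<forall>\<^sub>F n in sequentially. cdf (cond_law M (\<lambda>\<omega>. partial_max X n \<omega> / T n \<omega>)
        {\<omega> \<in> space M. x n \<le> T n \<omega>}) u =
      cdf (cond_law M (\<lambda>\<omega>. partial_max X n \<omega> / (partial_sum X n \<omega> - b n))
        {\<omega> \<in> space M. partial_sum X n \<omega> - b n \<ge> x n}) u" for u
    using ev by eventually_elim simp
  then show ?thesis
    using conv unfolding weak_conv_m_def weak_conv_def by (blast intro: Lim_transform_eventually)
qed

end
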